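(* Consider the overlaid primary and secondary networks on the unit square operating under the primary and secondary protocols described in the context, with secondary cell area $a_s(m)=\frac{k_2\log m}{m}$. Then the packet delay $D_s(m)$ of the secondary network satisfies $$D_s(m)=\Theta\left(\frac{1}{\sqrt{a_s(m)}}\right)\quad\text{w.h.p.}$$
   Context: W.h.p. means with probability tending to 1 as $n\to\infty$ (equivalently $m\to\infty$). $O,\Omega,\Theta$ have their usual asymptotic meaning; $\log$ is the natural logarithm in the cell sizes. Network model. Primary nodes form a Poisson point process of density $n$ on the unit square and secondary nodes a Poisson point process of density $m=n^\beta$, $\beta>1$. Nodes of each network are randomly grouped into one-to-one source-destination (S-D) pairs. The channel power gain at distance $r$ is $g(r)=r^{-\alpha}$, $\alpha>2$, with noise power $N_0$ and unit bandwidth. An active transmitter (TX)/receiver (RX) pair at distance $d$ with transmit power $P$ has rate $\log\left(1+\frac{P g(d)}{N_0+I}\right)$, where $I$ is the total interference at the RX from all other active TXs of both networks (a TX of power $P'$ at distance $r$ contributes $P'g(r)$). Primary protocol. The unit square is divided into square primary cells of area $a_p=\frac{k_1\log n}{n}$, $k_1\ge1$, grouped into clusters of $25$ ($5\times5$) cells. Time is split into TDMA frames of 25 slots, each of constant length $t_p$; in each slot one cell per cluster is active, cells taking turns in round-robin fashion, with the same pattern in all clusters. The data path of an S-D pair is the horizontal line (HDP) followed by the vertical line (VDP) connecting source to destination. In each cell one node is the designated relay node (nodes take turns). When a cell is active, its slot is divided into packet slots, one for each data path passing through or originating from the cell: the relay transmits one packet for each path passing through the cell, then each source in the cell transmits one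 packet. Each packet goes to the relay node of the neighboring cell along the data path, or directly to the destination if that is the next hop (the destination may be in the same or a neighboring cell). Received packets are buffered and sent in the next active slot of the cell. TX power is $P_0a_p^{\alpha/2}$, $P_0$ constant. Secondary protocol. Same construction with square secondary cells of area $a_s=\frac{k_2\log m}{m}$, $k_2=k_1\ge1$, clusters of 25 cells, 25-slot TDMA, horizontal-then-vertical data paths, relay nodes, and TX power $P_1a_s^{\alpha/2}$, $P_1$ constant; one secondary TDMA frame has the duration $t_p$ of one primary slot. Around each primary cell containing an active primary TX there is a preservation region, a square of $M^2$ secondary cells, $M=\lfloor 3\sqrt{a_p/a_s}\rfloor+2$, in which no secondary node may transmit (but may receive). A relay node in a preservation region buffers packets until the region is cleared and its cell is active. Fluid model: the packet size scales proportionally to the throughput (arbitrarily small as the density grows), so that each packet arriving at a cell is sent at the next transmission opportunity of that cell. Delay. For a network with $n_t$ nodes, the delay $D_i(j)$ of packet $j$ of S-D pair $i$ is the time from departure from the source to arrival at the destination; $D_i=\limsup_{k\to\infty}\frac1k\sum_{j=1}^kD_i(j)$; and the packet delay is $D(n_t)=\frac{2}{n_t}\sum_{i=1}^{n_t/2}E[D_i]$. For the secondary network it is written $D_s(m)$. *)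

theory Defs
  imports "HOL-Probability.Probability" "HOL-Combinatorics.Combinatorics"
begin

section \<open>Random networks on the unit square\<close>

type_synonym point = "real \<times> real"
type_synonym cell = "int \<times> int"

text \<open>
  A realization of one network: the nodes are \<open>0, \<dots>, nodes - 1\<close>, and \<open>pairing\<close> is an
  ordering of them; the \<open>i\<close>-th S-D pair consists of its entries \<open>2 * i\<close> and \<open>2 * i + 1\<close>
  (if the number of nodes is odd, the last entry stays unpaired).
\<close>

record network =
  nodes :: nat
  pos :: "nat \<Rightarrow> point"
  pairing :: "nat list"

definition n_pairs :: "('r) network_scheme \<Rightarrow> nat" where
  "n_pairs X = nodes X div 2"

definition src :: "('r) network_scheme \<Rightarrow> nat \<Rightarrow> nat" where
  "src X i = pairing X ! (2 * i)"

definition dst :: "('r) network_scheme \<Rightarrow> nat \<Rightarrow> nat" where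
  "dst X i = pairing X ! (2 * i + 1)"

text \<open>Half-open, so that it is tiled exactly by half-open square cells.\<close>

definition unit_square :: "point set" where
  "unit_square = {0..<1} \<times> {0..<1}"

definition node_count :: "network \<Rightarrow> point set \<Rightarrow> nat" where
  "node_count X B = card {u. u < nodes X \<and> pos X u \<in> B}"

definition poisson_process :: "'a measure \<Rightarrow> real \<Rightarrow> ('a \<Rightarrow> network) \<Rightarrow> bool" where
  "poisson_process M d X \<longleftrightarrow>
     (\<lambda>\<omega>. nodes (X \<omega>)) \<in> measurable M (count_space UNIV) \<and>
     (\<forall>u. (\<lambda>\<omega>. pos (X \<omega>) u) \<in> borel_measurable M) \<and>
     (\<forall>\<omega>\<in>space M. \<forall>u<nodes (X \<omega>). pos (X \<omega>) u \<in> unit_square) \<and>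
     (\<forall>B k. B \<in> sets borel \<longrightarrow> B \<subseteq> unit_square \<longrightarrow>
        measure M {\<omega> \<in> space M. node_count (X \<omega>) B = k} =
          (d * measure lborel B) ^ k / fact k * exp (- (d * measure lborel B))) \<and>
     (\<forall>F. finite F \<longrightarrow> disjoint F \<longrightarrow> (\<forall>B\<in>F. B \<in> sets borel \<and> B \<subseteq> unit_square) \<longrightarrow>
        prob_space.indep_vars M (\<lambda>_. count_space UNIV) (\<lambda>B \<omega>. node_count (X \<omega>) B) F)"

text \<open>
  Given the number of nodes and their positions, the ordering that determines the pairs is
  uniform among the \<open>k!\<close> orderings; the conditional law is expressed on the generating family
  of events \<open>nodes = k \<and> (\<forall>u<k. pos u \<in> B u)\<close>.
\<close>

definition random_pairing :: "'a measure \<Rightarrow> ('a \<Rightarrow> network) \<Rightarrow> bool" where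
  "random_pairing M X \<longleftrightarrow>
     (\<lambda>\<omega>. pairing (X \<omega>)) \<in> measurable M (count_space UNIV) \<and>
     (\<forall>\<omega>\<in>space M. pairing (X \<omega>) \<in> permutations_of_set {..<nodes (X \<omega>)}) \<and>
     (\<forall>k xs B. xs \<in> permutations_of_set {..<k} \<longrightarrow> (\<forall>u<k. B u \<in> sets borel) \<longrightarrow>
        measure M {\<omega> \<in> space M. nodes (X \<omega>) = k \<and> (\<forall>u<k. pos (X \<omega>) u \<in> B u) \<and>
                                 pairing (X \<omega>) = xs} =
        measure M {\<omega> \<in> space M. nodes (X \<omega>) = k \<and> (\<forall>u<k. pos (X \<omega>) u \<in> B u)} / fact k)"

definition random_network :: "'a measure \<Rightarrow> real \<Rightarrow> ('a \<Rightarrow> network) \<Rightarrow> bool" where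
  "random_network M d X \<longleftrightarrow>
     prob_space M \<and> poisson_process M d X \<and> random_pairing M X"


section \<open>Cells and data paths\<close>

text \<open>
  The nominal cell area \<open>c ln d / d\<close> at node density \<open>d\<close>. Its inverse square root is in general
  not an integer; the unit square is divided into \<open>K * K\<close> equal square cells, where
  \<open>K = grid_size a\<close> is the largest number for which their area \<open>1 / K\<^sup>2\<close> is at least the nominal
  area \<open>a\<close>.
\<close>

definition nominal_area :: "real \<Rightarrow> real \<Rightarrow> real" where
  "nominal_area c d = c * ln d / d"

definition grid_size :: "real \<Rightarrow> nat" where
  "grid_size a = nat \<lfloor>1 / sqrt a\<rfloor>"

definition cell_area :: "nat \<Rightarrow> real" where
  "cell_area K = 1 / (real K)\<^sup>2"

definition cells :: "nat \<Rightarrow> cell set" where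
  "cells K = {0..<int K} \<times> {0..<int K}"

definition cell_of_point :: "nat \<Rightarrow> point \<Rightarrow> cell" where
  "cell_of_point K x = (\<lfloor>real K * fst x\<rfloor>, \<lfloor>real K * snd x\<rfloor>)"

definition all_occupied :: "nat \<Rightarrow> network \<Rightarrow> bool" where
  "all_occupied K X \<longleftrightarrow> (\<forall>c\<in>cells K. \<exists>u<nodes X. cell_of_point K (pos X u) = c)"

definition line :: "int \<Rightarrow> int \<Rightarrow> int list" where
  "line a b = (if a \<le> b then [a..b] else rev [b..a])"

definition hv_path :: "cell \<Rightarrow> cell \<Rightarrow> cell list" where
  "hv_path c d = map (\<lambda>x. (x, snd c)) (line (fst c) (fst d)) @
                 map (\<lambda>y. (fst d, y)) (tl (line (snd c) (snd d)))"

text \<open>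
  A network together with everything that governs its transmissions: the grid, the slot length,
  the power, the slots in which a cell is active and permitted to transmit, the
  order in which an active cell serves its data paths in a given slot, and the designated relay
  node of a cell for a given slot of the cell.
\<close>

record tier = network +
  grid :: nat
  slot_len :: real
  tx_power :: real
  may_transmit :: "cell \<Rightarrow> nat \<Rightarrow> bool"
  order :: "cell \<Rightarrow> nat \<Rightarrow> nat list"
  relay :: "cell \<Rightarrow> nat \<Rightarrow> nat"

definition node_cell :: "tier \<Rightarrow> nat \<Rightarrow> cell" where
  "node_cell T u = cell_of_point (grid T) (pos T u)"

definition data_path :: "tier \<Rightarrow> nat \<Rightarrow> cell list" where
  "data_path T i = hv_path (node_cell T (src T i)) (node_cell T (dst T i))"

text \<open>
  The \<open>l\<close>-th transmission of a packet of pair \<open>i\<close> is made from the cell \<open>data_path T i ! l\<close>. The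
  last one goes directly to the destination, from the cell before the destination's cell, or
  from the source if source and destination share a cell.
\<close>

definition hops :: "tier \<Rightarrow> nat \<Rightarrow> nat" where
  "hops T i = max 1 (length (data_path T i) - 1)"

definition originating :: "tier \<Rightarrow> cell \<Rightarrow> nat set" where
  "originating T c = {i. i < n_pairs T \<and> node_cell T (src T i) = c}"

definition passing :: "tier \<Rightarrow> cell \<Rightarrow> nat set" where
  "passing T c = {i. i < n_pairs T \<and> (\<exists>l. 0 < l \<and> l < hops T i \<and> data_path T i ! l = c)}"


section \<open>Time division and transmissions\<close>

text \<open>
  Clusters are the \<open>5 \<times> 5\<close> blocks of cells; \<open>pat\<close> lists the 25 positions within a cluster
  in the order in which they take turns. Slot \<open>k\<close> of a network occupies the time interval from
  \<open>slot_len * k\<close> to \<open>slot_len * (k + 1)\<close>.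
\<close>

definition round_robin_pattern :: "(nat \<Rightarrow> cell) \<Rightarrow> bool" where
  "round_robin_pattern pat \<longleftrightarrow> bij_betw pat {..<25} ({0..<5} \<times> {0..<5})"

definition active :: "(nat \<Rightarrow> cell) \<Rightarrow> cell \<Rightarrow> nat \<Rightarrow> bool" where
  "active pat c k \<longleftrightarrow> (fst c mod 5, snd c mod 5) = pat (k mod 25)"

definition next_opportunity :: "tier \<Rightarrow> cell \<Rightarrow> nat \<Rightarrow> nat" where
  "next_opportunity T c k = (LEAST k'. k < k' \<and> may_transmit T c k')"

text \<open>
  An active slot is divided into equal packet slots, first those of the paths passing through the
  cell (served by the relay), then those of the paths originating there (served by the
  sources). The designated relay of each slot is an arbitrary node of the cell, which covers every
  way of taking turns.
\<close>

definition valid_schedule :: "tier \<Rightarrow> bool" where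
  "valid_schedule T \<longleftrightarrow>
     (\<forall>c\<in>cells (grid T). \<forall>k. may_transmit T c k \<longrightarrow>
        relay T c k < nodes T \<and> node_cell T (relay T c k) = c \<and>
        (\<exists>xs ys. order T c k = xs @ ys \<and> distinct (xs @ ys) \<and>
                 set xs = passing T c \<and> set ys = originating T c))"

definition slot_at :: "tier \<Rightarrow> real \<Rightarrow> nat" where
  "slot_at T t = nat \<lfloor>t / slot_len T\<rfloor>"

definition transmitting_cells :: "tier \<Rightarrow> real \<Rightarrow> cell set" where
  "transmitting_cells T t =
     {c \<in> cells (grid T). may_transmit T c (slot_at T t) \<and> order T c (slot_at T t) \<noteq> []}"

definition served_path :: "tier \<Rightarrow> cell \<Rightarrow> real \<Rightarrow> nat" where
  "served_path T c t =
     (let k = slot_at T t; ps = order T c k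
      in ps ! nat \<lfloor>(t / slot_len T - real k) * real (length ps)\<rfloor>)"

definition sender :: "tier \<Rightarrow> cell \<Rightarrow> real \<Rightarrow> nat" where
  "sender T c t =
     (let i = served_path T c t
      in if node_cell T (src T i) = c then src T i else relay T c (slot_at T t))"

text \<open>
  In slot \<open>k\<close>, transmission \<open>l\<close> of path \<open>i\<close> is addressed to the node that will be the relay of the
  next cell when that cell forwards the packet, i.e. at its next opportunity.
\<close>

definition receiver :: "tier \<Rightarrow> nat \<Rightarrow> nat \<Rightarrow> nat \<Rightarrow> nat" where
  "receiver T i l k =
     (if Suc l = hops T i then dst T i
      else let c = data_path T i ! Suc l in relay T c (next_opportunity T c k))"

definition received_power :: "real \<Rightarrow> tier \<Rightarrow> cell \<Rightarrow> real \<Rightarrow> point \<Rightarrow> real" where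
  "received_power \<alpha> T c t y = tx_power T * dist (pos T (sender T c t)) y powr (- \<alpha>)"

text \<open>
  The rate at time \<open>t\<close> of transmission \<open>l\<close> of path \<open>i\<close> in \<open>T\<close>, under interference from all
  other active transmitters of \<open>T\<close> and of the coexisting network \<open>T'\<close>.
\<close>

definition link_rate ::
    "real \<Rightarrow> real \<Rightarrow> tier \<Rightarrow> tier \<Rightarrow> nat \<Rightarrow> nat \<Rightarrow> real \<Rightarrow> real" where
  "link_rate \<alpha> noise T' T i l t =
     (let c = data_path T i ! l;
          y = pos T (receiver T i l (slot_at T t));
          interference =
            (\<Sum>c'\<in>transmitting_cells T t - {c}. received_power \<alpha> T c' t y) +
            (\<Sum>c'\<in>transmitting_cells T' t. received_power \<alpha> T' c' t y)
      in ln (1 + received_power \<alpha> T c t y / (noise + interference)))"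

text \<open>
  The slot in which packet \<open>j\<close> of pair \<open>i\<close> makes its \<open>l\<close>-th transmission under the fluid model:
  a source sends one packet per opportunity, and a packet received in a slot is forwarded
  at the very next opportunity of the receiving cell (which is not active in the same slot).
\<close>

primrec hop_slot :: "tier \<Rightarrow> nat \<Rightarrow> nat \<Rightarrow> nat \<Rightarrow> nat" where
  "hop_slot T i j 0 = enumerate {k. may_transmit T (data_path T i ! 0) k} j"
| "hop_slot T i j (Suc l) = next_opportunity T (data_path T i ! Suc l) (hop_slot T i j l)"


section \<open>The overlaid networks\<close>

record parameters =
  path_loss :: real       \<comment> \<open>\<open>\<alpha>\<close>\<close>
  noise_power :: real     \<comment> \<open>\<open>N\<^sub>0\<close>\<close>
  density_exp :: real     \<comment> \<open>\<open>\<beta>\<close>\<close>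
  k_prim :: real          \<comment> \<open>\<open>k\<^sub>1\<close>\<close>
  k_sec :: real           \<comment> \<open>\<open>k\<^sub>2\<close>\<close>
  power_prim :: real      \<comment> \<open>\<open>P\<^sub>0\<close>\<close>
  power_sec :: real       \<comment> \<open>\<open>P\<^sub>1\<close>\<close>
  slot_prim :: real       \<comment> \<open>\<open>t\<^sub>p\<close>\<close>
  pattern_prim :: "nat \<Rightarrow> cell"
  pattern_sec :: "nat \<Rightarrow> cell"

definition m_of :: "parameters \<Rightarrow> real \<Rightarrow> real" where
  "m_of C n = n powr density_exp C"

definition grid_prim :: "parameters \<Rightarrow> real \<Rightarrow> nat" where
  "grid_prim C n = grid_size (nominal_area (k_prim C) n)"

definition grid_sec :: "parameters \<Rightarrow> real \<Rightarrow> nat" where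
  "grid_sec C n = grid_size (nominal_area (k_sec C) (m_of C n))"

text \<open>
  Choices left open by the two protocols and the resulting packet times: \<open>depart i j l\<close> and
  \<open>arrive i j l\<close> are the times at which the \<open>l\<close>-th transmission of packet \<open>j\<close> of secondary pair
  \<open>i\<close> starts and ends.
\<close>

record execution =
  order_prim :: "cell \<Rightarrow> nat \<Rightarrow> nat list"
  relay_prim :: "cell \<Rightarrow> nat \<Rightarrow> nat"
  order_sec :: "cell \<Rightarrow> nat \<Rightarrow> nat list"
  relay_sec :: "cell \<Rightarrow> nat \<Rightarrow> nat"
  packet_size :: real
  depart :: "nat \<Rightarrow> nat \<Rightarrow> nat \<Rightarrow> real"
  arrive :: "nat \<Rightarrow> nat \<Rightarrow> nat \<Rightarrow> real"

definition primary_tier :: "parameters \<Rightarrow> real \<Rightarrow> network \<Rightarrow> execution \<Rightarrow> tier" where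
  "primary_tier C n X E =
     \<lparr> nodes = nodes X, pos = pos X, pairing = pairing X,
       grid = grid_prim C n,
       slot_len = slot_prim C,
       tx_power = power_prim C * cell_area (grid_prim C n) powr (path_loss C / 2),
       may_transmit = (\<lambda>c k. c \<in> cells (grid_prim C n) \<and> active (pattern_prim C) c k),
       order = order_prim E, relay = relay_prim E \<rparr>"

text \<open>
  The preservation region of a primary cell is the square of \<open>M * M\<close> secondary cells whose lower
  left cell contains the lower left corner of the \<open>3 \<times> 3\<close> block of primary cells around
  that cell; by the choice of \<open>M\<close> it covers this block. It may stick out of the unit square.
\<close>

definition preservation_region :: "nat \<Rightarrow> nat \<Rightarrow> cell \<Rightarrow> cell set" where
  "preservation_region Kp Ks b =
     (let M = \<lfloor>3 * sqrt (cell_area Kp / cell_area Ks)\<rfloor> + 2;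
          x = \<lfloor>real_of_int (fst b - 1) * real Ks / real Kp\<rfloor>;
          y = \<lfloor>real_of_int (snd b - 1) * real Ks / real Kp\<rfloor>
      in {x..<x + M} \<times> {y..<y + M})"

definition preserved :: "parameters \<Rightarrow> real \<Rightarrow> tier \<Rightarrow> nat \<Rightarrow> cell set" where
  "preserved C n Tp q =
     (\<Union>b\<in>{b. may_transmit Tp b q \<and> passing Tp b \<union> originating Tp b \<noteq> {}}.
        preservation_region (grid_prim C n) (grid_sec C n) b)"

text \<open>A secondary frame of 25 slots fills one primary slot, so slot \<open>k\<close> lies in primary slot
  \<open>k div 25\<close>.\<close>

definition secondary_tier ::
    "parameters \<Rightarrow> real \<Rightarrow> network \<Rightarrow> network \<Rightarrow> execution \<Rightarrow> tier" where
  "secondary_tier C n Xp Xs E =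
     \<lparr> nodes = nodes Xs, pos = pos Xs, pairing = pairing Xs,
       grid = grid_sec C n,
       slot_len = slot_prim C / 25,
       tx_power = power_sec C * cell_area (grid_sec C n) powr (path_loss C / 2),
       may_transmit = (\<lambda>c k. c \<in> cells (grid_sec C n) \<and> active (pattern_sec C) c k \<and>
                             c \<notin> preserved C n (primary_tier C n Xp E) (k div 25)),
       order = order_sec E, relay = relay_sec E \<rparr>"

text \<open>
  Each transmission takes place within the packet slot of its path, and takes
  the time that the link needs to carry one packet. Several packets of a path that are
  sent in the same packet slot are sent one after the other. That they all fit is the fluid
  model: packets are small enough for each to leave at the next opportunity.
\<close>

definition valid_execution ::
    "parameters \<Rightarrow> real \<Rightarrow> network \<Rightarrow> network \<Rightarrow> execution \<Rightarrow> bool" where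
  "valid_execution C n Xp Xs E \<longleftrightarrow>
     (let Tp = primary_tier C n Xp E; Ts = secondary_tier C n Xp Xs E in
        valid_schedule Tp \<and> valid_schedule Ts \<and> 0 < packet_size E \<and>
        (\<forall>i<n_pairs Ts. \<forall>l<hops Ts i.
           (\<forall>j. let k = hop_slot Ts i j l; ps = order Ts (data_path Ts i ! l) k in
              (\<exists>a<length ps. ps ! a = i \<and>
                 slot_len Ts * (real k + real a / real (length ps)) \<le> depart E i j l \<and>
                 arrive E i j l \<le> slot_len Ts * (real k + real (a + 1) / real (length ps))) \<and>
              depart E i j l < arrive E i j l \<and>
              (link_rate (path_loss C) (noise_power C) Tp Ts i l has_integral packet_size E)
                {depart E i j l..arrive E i j l}) \<and>
           (\<forall>j j'. j < j' \<longrightarrow> hop_slot Ts i j l = hop_slot Ts i j' l \<longrightarrow>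
              arrive E i j l \<le> depart E i j' l)))"


section \<open>Packet delay\<close>

definition packet_delay_of :: "tier \<Rightarrow> execution \<Rightarrow> nat \<Rightarrow> nat \<Rightarrow> real" where
  "packet_delay_of T E i j = arrive E i j (hops T i - 1) - depart E i j 0"

definition pair_delay :: "tier \<Rightarrow> execution \<Rightarrow> nat \<Rightarrow> ennreal" where
  "pair_delay T E i =
     limsup (\<lambda>k. (\<Sum>j<k. ennreal (packet_delay_of T E i j)) / of_nat k)"

text \<open>
  The packet delay of the secondary network for a given realization \<open>Xp\<close>, \<open>Xs\<close> of the two networks;
  the expectation is over the randomness \<open>R\<close> remaining in the execution \<open>E\<close> of the protocols.
\<close>

definition secondary_delay ::
    "parameters \<Rightarrow> real \<Rightarrow> network \<Rightarrow> network \<Rightarrow> 'b measure \<Rightarrow> ('b \<Rightarrow> execution) \<Rightarrow> ennreal" where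
  "secondary_delay C n Xp Xs R E =
     2 / of_nat (nodes Xs) *
       (\<Sum>i<n_pairs Xs. \<integral>\<^sup>+\<rho>. pair_delay (secondary_tier C n Xp Xs (E \<rho>)) (E \<rho>) i \<partial>R)"

text \<open>With probability tending to 1; the events \<open>A n\<close> spare a measurability assumption on \<open>P\<close>.\<close>

definition whp :: "(real \<Rightarrow> 'a measure) \<Rightarrow> (real \<Rightarrow> 'a \<Rightarrow> bool) \<Rightarrow> bool" where
  "whp M P \<longleftrightarrow>
     (\<exists>A. (\<forall>\<^sub>F n in at_top. A n \<in> sets (M n) \<and> (\<forall>\<omega>\<in>A n. P n \<omega>)) \<and>
          ((\<lambda>n. measure (M n) (A n)) \<longlongrightarrow> 1) at_top)"

definition theta_whp ::
    "(real \<Rightarrow> 'a measure) \<Rightarrow> (real \<Rightarrow> 'a \<Rightarrow> ennreal) \<Rightarrow> (real \<Rightarrow> real) \<Rightarrow> bool" where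
  "theta_whp M D f \<longleftrightarrow>
     (\<exists>c1>0. \<exists>c2>0. whp M (\<lambda>n \<omega>. ennreal (c1 * f n) \<le> D n \<omega> \<and> D n \<omega> \<le> ennreal (c2 * f n)))"

end

theory Submission
  imports Defs "HOL-Real_Asymp.Real_Asymp"
begin

text \<open>
  Upper bound: once the secondary cells are small compared with the primary ones, the preservation
  regions that can cover a given secondary cell come from at most four consecutive rows of primary
  cells. One of the five row residues is thus harmless, and every cell may transmit at least once
  in 25 secondary frames, that is, in 625 slots. Since a path has at most \<open>2 K\<close> hops on a
  \<open>K \<times> K\<close> grid, every packet arrives after \<open>O(K)\<close> slots.

  Lower bound: each hop takes at least one slot, and a pair whose source lies in the left quarter
  and whose destination lies in the right quarter of the square has at least about \<open>K / 2\<close> hops.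
  With high probability each quarter contains a constant fraction of all nodes, and then a constant
  fraction of the uniformly random pairs cross in this way. Both facts follow from exponential
  Markov inequalities; for the pairing, the expectation is bounded by drawing the pairs one by one.
\<close>

section \<open>Poisson counts\<close>

text \<open>Measurability of a count is read off the independence clause of
  \<open>poisson_process\<close>: for the one-element family \<open>{B}\<close>,
  \<open>indep_vars\<close> already contains it.\<close>

lemma node_count_measurable:
  assumes "prob_space M" and "poisson_process M d X" and "B \<in> sets borel" and "B \<subseteq> unit_square"
  shows "(\<lambda>\<omega>. node_count (X \<omega>) B) \<in> measurable M (count_space UNIV)"
proof -
  interpret prob_space M by fact
  have "finite F \<Longrightarrow> disjoint F \<Longrightarrow> (\<forall>B\<in>F. B \<in> sets borel \<and> B \<subseteq> unit_square) \<Longrightarrow>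
        indep_vars (\<lambda>_. count_space UNIV) (\<lambda>B \<omega>. node_count (X \<omega>) B) F" for F
    using assms(2) unfolding poisson_process_def by blast
  from this[of "{B}"] have "indep_vars (\<lambda>_. count_space UNIV) (\<lambda>B \<omega>. node_count (X \<omega>) B) {B}"
    using assms(3,4) by simp
  then show ?thesis unfolding indep_vars_def by simp
qed

lemma node_count_sets:
  assumes "prob_space M" and "poisson_process M d X" and "B \<in> sets borel" and "B \<subseteq> unit_square"
  shows "{\<omega> \<in> space M. P (node_count (X \<omega>) B)} \<in> sets M"
  using measurable_sets[OF node_count_measurable[OF assms], of "Collect P"]
  by (simp add: vimage_def Int_def conj_commute)

text \<open>Markov's inequality for \<open>z powr N\<close>, where \<open>N\<close> is the Poisson number of nodes in \<open>B\<close>.\<close>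

lemma node_count_tail:
  assumes "prob_space M" and "poisson_process M d X" and "B \<in> sets borel" and "B \<subseteq> unit_square"
    and "z > 0" and "d \<ge> 0" and S: "\<And>k. k \<in> S \<Longrightarrow> 1 \<le> z powr (real k - c)"
  shows "measure M {\<omega> \<in> space M. node_count (X \<omega>) B \<in> S}
           \<le> exp ((z - 1) * (d * measure lborel B)) * z powr (- c)"
proof -
  interpret prob_space M by fact
  define \<mu> where "\<mu> = d * measure lborel B"
  have mu: "\<mu> \<ge> 0" using \<open>d \<ge> 0\<close> unfolding \<mu>_def by simp
  define E where "E k = {\<omega> \<in> space M. node_count (X \<omega>) B = k \<and> k \<in> S}" for k
  have E_sets: "E k \<in> sets M" for k
    unfolding E_def by (rule node_count_sets[OF assms(1-4)])
  have "disjoint_family E" unfolding disjoint_family_on_def E_def by auto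
  with E_sets have sums: "(\<lambda>k. measure M (E k)) sums measure M (\<Union>k. E k)"
    by (intro finite_measure_UNION) auto
  \<comment> \<open>On \<open>S\<close> the Poisson mass may be multiplied by
    \<open>z powr (k - c)\<close>, which is at least 1; off \<open>S\<close> the event is empty.
    Either way the bound is a term of the exponential series at \<open>z * \<mu>\<close> times a
    constant, so it can be summed in closed form.\<close>
  have bound: "measure M (E k) \<le> ((z * \<mu>) ^ k /\<^sub>R fact k) * (exp (-\<mu>) * z powr (- c))" for k
  proof (cases "k \<in> S")
    case True
    have "measure M (E k) = \<mu> ^ k / fact k * exp (- \<mu>)"
      using assms(2-4) True unfolding E_def poisson_process_def \<mu>_def by simp
    also have "\<dots> \<le> \<mu> ^ k / fact k * exp (- \<mu>) * z powr (real k - c)"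
      using S[OF True] mu mult_left_mono[of 1 "z powr (real k - c)" "\<mu> ^ k / fact k * exp (- \<mu>)"] by simp
    also have "z powr (real k - c) = z ^ k * z powr (- c)"
      using \<open>z > 0\<close> powr_add[of z "real k" "-c"] by (simp add: powr_realpow)
    finally show ?thesis by (simp add: power_mult_distrib divide_simps mult_ac)
  next
    case False
    then have "E k = {}" unfolding E_def by auto
    then show ?thesis using mu \<open>z > 0\<close> by simp
  qed
  have "(\<lambda>k. ((z * \<mu>) ^ k /\<^sub>R fact k) * (exp (-\<mu>) * z powr (- c))) sums
          (exp (z * \<mu>) * (exp (-\<mu>) * z powr (- c)))"
    by (intro sums_mult2 exp_converges)
  from sums_le[OF bound sums this]
  have "measure M (\<Union>k. E k) \<le> exp (z * \<mu>) * (exp (-\<mu>) * z powr (- c))" .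
  also have "(\<Union>k. E k) = {\<omega> \<in> space M. node_count (X \<omega>) B \<in> S}" unfolding E_def by auto
  also have "exp (z * \<mu>) * (exp (-\<mu>) * z powr (- c)) = exp ((z - 1) * \<mu>) * z powr (- c)"
    by (simp add: exp_add[symmetric] algebra_simps)
  finally show ?thesis unfolding \<mu>_def .
qed

text \<open>The choice \<open>z = 2\<close>, with \<open>c\<close> twice the mean, gives the rate
  \<open>1 - 2 * ln 2\<close>, which is negative since ln 2 exceeds 1/2.\<close>

lemma node_count_upper_tail:
  assumes "prob_space M" and "poisson_process M d X" and "B \<in> sets borel" and "B \<subseteq> unit_square" "d \<ge> 0"
  shows "measure M {\<omega> \<in> space M. \<not> real (node_count (X \<omega>) B) \<le> 2 * (d * measure lborel B)}
           \<le> exp ((1 - 2 * ln 2) * (d * measure lborel B))"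
proof -
  let ?\<mu> = "d * measure lborel B"
  have "measure M {\<omega> \<in> space M. node_count (X \<omega>) B \<in> {k. \<not> real k \<le> 2 * ?\<mu>}}
           \<le> exp ((2 - 1) * ?\<mu>) * 2 powr (- (2 * ?\<mu>))"
    by (rule node_count_tail[OF assms(1-4)]) (use \<open>d \<ge> 0\<close> in \<open>auto simp: ge_one_powr_ge_zero\<close>)
  also have "\<dots> = exp ((1 - 2 * ln 2) * ?\<mu>)"
    by (simp add: powr_def exp_add[symmetric] algebra_simps)
  finally show ?thesis by simp
qed

text \<open>Here \<open>z = 1/2\<close>: a base below 1 gives weight to small counts. With
  \<open>c\<close> half the mean the rate is \<open>(ln 2 - 1) / 2 < 0\<close>.\<close>

lemma node_count_lower_tail:
  assumes "prob_space M" and "poisson_process M d X" and "B \<in> sets borel" and "B \<subseteq> unit_square" "d \<ge> 0"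
  shows "measure M {\<omega> \<in> space M. \<not> real (node_count (X \<omega>) B) \<ge> d * measure lborel B / 2}
           \<le> exp ((ln 2 - 1) / 2 * (d * measure lborel B))"
proof -
  let ?\<mu> = "d * measure lborel B"
  have "measure M {\<omega> \<in> space M. node_count (X \<omega>) B \<in> {k. \<not> real k \<ge> ?\<mu> / 2}}
           \<le> exp ((1/2 - 1) * ?\<mu>) * (1/2) powr (- (?\<mu> / 2))"
  proof (rule node_count_tail[OF assms(1-4)])
    fix k assume "k \<in> {k. \<not> real k \<ge> ?\<mu> / 2}"
    then show "1 \<le> (1/2) powr (real k - ?\<mu> / 2)"
      using ge_one_powr_ge_zero[of 2 "?\<mu>/2 - real k"] by (simp add: powr_divide powr_minus_divide[symmetric])
  qed (use \<open>d \<ge> 0\<close> in auto)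
  also have "\<dots> = exp ((ln 2 - 1) / 2 * ?\<mu>)"
    by (simp add: powr_def exp_add[symmetric] ln_div algebra_simps add_divide_distrib diff_divide_distrib)
  finally show ?thesis by simp
qed

section \<open>Occupancy of the cells\<close>

lemma measure_lborel_rectangle:
  fixes a b c d :: real
  assumes "a \<le> b" and "c \<le> d"
  shows "measure lborel ({a..<b} \<times> {c..<d}) = (b - a) * (d - c)"
proof -
  have "emeasure (lborel :: (real \<times> real) measure) ({a..<b} \<times> {c..<d}) =
      emeasure (lborel \<Otimes>\<^sub>M lborel) ({a..<b} \<times> {c..<d})"
    by (simp add: lborel_prod)
  also have "\<dots> = ennreal (b - a) * ennreal (d - c)"
    by (subst lborel.emeasure_pair_measure_Times) (use assms in auto)
  also have "\<dots> = ennreal ((b - a) * (d - c))" using assms by (simp add: ennreal_mult)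
  finally show ?thesis using assms by (simp add: measure_def)
qed

lemma borel_rectangle: "{a..<b} \<times> {c..<d} \<in> sets (borel :: (real \<times> real) measure)"
  unfolding borel_prod[symmetric] by (intro pair_measureI) auto

text \<open>Union bound over the cells. Rounding the grid size down makes each cell at least as
  large as the nominal area \<open>a\<close>, so it is empty with probability at most
  \<open>exp (- d * a) <= 1 / d\<close>, and there are at most \<open>1 / a\<close> cells; the
  product is \<open>1 / (c * ln d)\<close>.\<close>

lemma not_all_occupied_prob:
  assumes "prob_space M" and "poisson_process M d X" and "d > 1" and "c \<ge> 1"
  defines "K \<equiv> grid_size (nominal_area c d)"
  shows "{\<omega> \<in> space M. \<not> all_occupied K (X \<omega>)} \<in> sets M"
    and "measure M {\<omega> \<in> space M. \<not> all_occupied K (X \<omega>)} \<le> 1 / ln d"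
proof -
  interpret prob_space M by fact
  define B where "B b = {of_int (fst b) / real K ..< (of_int (fst b) + 1) / real K} \<times>
                        {of_int (snd b) / real K ..< (of_int (snd b) + 1) / real K}" for b :: cell
  have B_sets: "B b \<in> sets borel" for b unfolding B_def by (rule borel_rectangle)
  have B_sub: "B b \<subseteq> unit_square" if "b \<in> cells K" for b
  proof -
    have "of_int (fst b) / real K \<ge> 0" "(of_int (fst b) + 1) / real K \<le> 1"
         "of_int (snd b) / real K \<ge> 0" "(of_int (snd b) + 1) / real K \<le> 1"
      using that unfolding cells_def by (auto simp: divide_simps)
    then show ?thesis unfolding B_def unit_square_def by auto
  qed
  define V where "V b = {\<omega> \<in> space M. node_count (X \<omega>) (B b) = 0}" for b
  have V_sets: "V b \<in> sets M" if "b \<in> cells K" for b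
    unfolding V_def by (rule node_count_sets[OF assms(1,2) B_sets B_sub[OF that]])
  have V_prob: "measure M (V b) = exp (- (d / (real K)\<^sup>2))" if "b \<in> cells K" for b
  proof -
    have "K > 0" using that unfolding cells_def by auto
    then have "measure lborel (B b) = 1 / (real K)\<^sup>2"
      unfolding B_def by (subst measure_lborel_rectangle) (auto simp: divide_simps power2_eq_square)
    moreover have "measure M {\<omega> \<in> space M. node_count (X \<omega>) (B b) = 0} =
        (d * measure lborel (B b)) ^ 0 / fact 0 * exp (- (d * measure lborel (B b)))"
      using assms(2) B_sets[of b] B_sub[OF that] unfolding poisson_process_def by blast
    ultimately show ?thesis unfolding V_def by simp
  qed
  have eq: "{\<omega> \<in> space M. \<not> all_occupied K (X \<omega>)} = (\<Union>b\<in>cells K. V b)"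
  proof -
    have "(\<exists>u<nodes (X \<omega>). cell_of_point K (pos (X \<omega>) u) = b) \<longleftrightarrow> node_count (X \<omega>) (B b) \<noteq> 0"
      if "b \<in> cells K" for b \<omega>
    proof -
      have "K > 0" using that unfolding cells_def by auto
      then have "cell_of_point K x = b \<longleftrightarrow> x \<in> B b" for x
        unfolding cell_of_point_def B_def
        by (cases b; cases x) (auto simp: floor_eq_iff field_simps)
      then show ?thesis unfolding node_count_def by auto
    qed
    then show ?thesis unfolding all_occupied_def V_def by auto
  qed
  have fin: "finite (cells K)" unfolding cells_def by simp
  show "{\<omega> \<in> space M. \<not> all_occupied K (X \<omega>)} \<in> sets M"
    unfolding eq using V_sets fin by auto
  have "ln d > 0" using \<open>d > 1\<close> by simp
  \<comment> \<open>A nominal area above 1 gives \<open>K = 0\<close>; then there are no cells and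
    occupancy holds vacuously.\<close>
  show "measure M {\<omega> \<in> space M. \<not> all_occupied K (X \<omega>)} \<le> 1 / ln d"
  proof (cases "K = 0")
    case True
    then have "cells K = {}" unfolding cells_def by simp
    then show ?thesis unfolding eq using \<open>ln d > 0\<close> by simp
  next
    case False
    define a where "a = nominal_area c d"
    have a: "a = c * ln d / d" "a > 0" unfolding a_def nominal_area_def using assms(3,4) \<open>ln d > 0\<close> by auto
    have "real K \<le> 1 / sqrt a"
      unfolding K_def grid_size_def a_def[symmetric] using a by simp
    then have "(real K)\<^sup>2 \<le> (1 / sqrt a)\<^sup>2" by (intro power_mono) auto
    then have K2: "(real K)\<^sup>2 \<le> 1 / a" using a by (simp add: power_divide)
    have "measure M (\<Union>b\<in>cells K. V b) \<le> (\<Sum>b\<in>cells K. measure M (V b))"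
      using V_sets fin by (intro finite_measure_subadditive_finite) auto
    also have "\<dots> = (real K)\<^sup>2 * exp (- (d / (real K)\<^sup>2))"
      using V_prob by (simp add: cells_def card_cartesian_product power2_eq_square)
    also have "\<dots> \<le> (1 / a) * exp (- (d * a))"
    proof (rule mult_mono[OF K2])
      have "a \<le> 1 / (real K)\<^sup>2" using K2 a(2) False by (simp add: divide_simps mult_ac split: if_splits)
      then have "d * a \<le> d * (1 / (real K)\<^sup>2)" using \<open>d > 1\<close> by (intro mult_left_mono) auto
      then show "exp (- (d / (real K)\<^sup>2)) \<le> exp (- (d * a))" by simp
    qed (use a(2) in auto)
    also have "\<dots> \<le> (1 / a) * (1 / d)"
    proof (rule mult_left_mono)
      have "exp (- (d * a)) \<le> exp (- ln d)"
        using a(1) \<open>c \<ge> 1\<close> \<open>ln d > 0\<close> \<open>d > 1\<close> by simp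
      also have "exp (- ln d) = 1 / d" using \<open>d > 1\<close> by (simp add: exp_minus divide_simps)
      finally show "exp (- (d * a)) \<le> 1 / d" .
    qed (use a(2) in simp)
    also have "(1 / a) * (1 / d) = 1 / (c * ln d)" using a(1) \<open>d > 1\<close> by simp
    also have "\<dots> \<le> 1 / ln d" using \<open>c \<ge> 1\<close> \<open>ln d > 0\<close> by (simp add: divide_simps)
    finally show ?thesis unfolding eq .
  qed
qed

section \<open>Random pairings\<close>

text \<open>Two entries are consumed per step, which fits the induction that draws one pair after
  another; \<open>cross_pairs_eq_card\<close> returns to the count of indices used for
  networks.\<close>

primrec cross_pairs :: "'b set \<Rightarrow> 'b set \<Rightarrow> nat \<Rightarrow> 'b list \<Rightarrow> nat" where
  "cross_pairs L R 0 xs = 0"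
| "cross_pairs L R (Suc t) xs =
     of_bool (xs ! 0 \<in> L \<and> xs ! 1 \<in> R) + cross_pairs L R t (drop 2 xs)"

text \<open>Used twice in a row, this conditions a uniform ordering on its first pair.\<close>

lemma sum_permutations_of_set:
  assumes "finite A" and "A \<noteq> {}"
  shows "(\<Sum>xs\<in>permutations_of_set A. f xs) =
         (\<Sum>x\<in>A. \<Sum>ys\<in>permutations_of_set (A - {x}). f (x # ys))"
proof -
  have "(\<Sum>xs\<in>permutations_of_set A. f xs) =
        (\<Sum>x\<in>A. sum f ((\<lambda>xs. x # xs) ` permutations_of_set (A - {x})))"
    unfolding permutations_of_set_nonempty[OF assms(2)]
    using assms(1) by (intro sum.UNION_disjoint) auto
  also have "\<dots> = (\<Sum>x\<in>A. \<Sum>ys\<in>permutations_of_set (A - {x}). f (x # ys))"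
    by (rule sum.cong[OF refl], subst sum.reindex) (auto simp: inj_on_def)
  finally show ?thesis .
qed

text \<open>
  Draw the pairs one by one: as long as both sets still contain \<open>h\<close> of the at most \<open>k\<close> remaining
  elements, the next pair crosses with conditional probability at least \<open>(h / k)\<^sup>2\<close>.
\<close>

lemma sum_half_power_cross_pairs:
  assumes "finite A" and "card A \<le> k" and "L \<inter> R = {}"
    and "h + 2 * t \<le> card (L \<inter> A)" and "h + 2 * t \<le> card (R \<inter> A)"
  shows "(\<Sum>xs\<in>permutations_of_set A. (1 / 2) ^ cross_pairs L R t xs)
           \<le> fact (card A) * (1 - (real h / real k)\<^sup>2 / 2) ^ t"
  using assms
proof (induction t arbitrary: A)
  case 0
  then show ?case by simp
next
  case (Suc t)
  define N where "N = card A"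
  define p where "p = (real h / real k)\<^sup>2"
  have cardLA: "card (L \<inter> A) \<le> N" unfolding N_def using Suc.prems(1) by (intro card_mono) auto
  have "N \<ge> 2" using Suc.prems(4) cardLA by simp
  moreover have "N \<le> k" using Suc.prems(2) N_def by simp
  moreover have "h \<le> N" using Suc.prems(4) cardLA by linarith
  ultimately have N2: "N \<ge> 2" "N \<le> k" "h \<le> k" by auto
  then have "real h / real k \<le> 1" "real h / real k \<ge> 0" by (auto simp: divide_simps)
  then have p: "p \<le> 1" "p \<ge> 0" unfolding p_def by (auto intro: power_le_one)
  define w :: "'a \<Rightarrow> 'a \<Rightarrow> real" where "w a b = (1 / 2) ^ of_bool (a \<in> L \<and> b \<in> R)" for a b
  have "A \<noteq> {}" using N2 N_def by auto
  have split: "(\<Sum>xs\<in>permutations_of_set A. (1 / 2) ^ cross_pairs L R (Suc t) xs) =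
        (\<Sum>a\<in>A. \<Sum>b\<in>A - {a}. w a b *
           (\<Sum>ys\<in>permutations_of_set (A - {a} - {b}). (1 / 2) ^ cross_pairs L R t ys))"
    (is "_ = ?S")
  proof (subst sum_permutations_of_set[OF Suc.prems(1) \<open>A \<noteq> {}\<close>], rule sum.cong[OF refl])
    fix a assume "a \<in> A"
    have "A \<noteq> {a}" using N2 N_def by auto
    then have "A - {a} \<noteq> {}" using \<open>A \<noteq> {}\<close> by blast
    then show "(\<Sum>ys\<in>permutations_of_set (A - {a}). (1 / 2) ^ cross_pairs L R (Suc t) (a # ys)) =
       (\<Sum>b\<in>A - {a}. w a b *
           (\<Sum>ys\<in>permutations_of_set (A - {a} - {b}). (1 / 2) ^ cross_pairs L R t ys))"
      using Suc.prems(1)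
      by (subst sum_permutations_of_set) (auto simp: sum_distrib_left power_add w_def)
  qed
  \<comment> \<open>Removing two elements takes at most two from each of the sets, which is what the
    slack \<open>2 * t\<close> in the hypotheses pays for.\<close>
  have IH: "(\<Sum>ys\<in>permutations_of_set (A - {a} - {b}). (1 / 2) ^ cross_pairs L R t ys)
          \<le> fact (N - 2) * (1 - p / 2) ^ t" if "a \<in> A" "b \<in> A - {a}" for a b
  proof -
    have eq: "A - {a} - {b} = A - {a, b}" by auto
    have c: "card (A - {a, b}) = N - 2"
      unfolding N_def using that Suc.prems(1) by (subst card_Diff_subset) auto
    have sub: "h + 2 * t \<le> card (Z \<inter> (A - {a, b}))" if "h + 2 * Suc t \<le> card (Z \<inter> A)" for Z
    proof -
      have "Z \<inter> (A - {a, b}) = Z \<inter> A - {a, b}" by auto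
      moreover have "card (Z \<inter> A) - card {a, b} \<le> card (Z \<inter> A - {a, b})"
        by (rule diff_card_le_card_Diff) simp
      moreover have "card {a, b} \<le> 2" by (simp add: card_insert_if)
      ultimately show ?thesis using that by simp
    qed
    show ?thesis
      using Suc.IH[of "A - {a} - {b}"] Suc.prems sub N2 c unfolding eq p_def by simp
  qed
  have nonneg: "0 \<le> (1 - p / 2) ^ t" using p by simp
  have "?S \<le> (\<Sum>a\<in>A. \<Sum>b\<in>A - {a}. w a b * (fact (N - 2) * (1 - p / 2) ^ t))"
    using IH by (intro sum_mono mult_left_mono) (auto simp: w_def)
  also have "\<dots> = (\<Sum>a\<in>A. \<Sum>b\<in>A - {a}. w a b) * (fact (N - 2) * (1 - p / 2) ^ t)"
    by (simp add: sum_distrib_right)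
  \<comment> \<open>Each crossing ordered pair saves 1/2 against the total
    \<open>N * (N - 1)\<close>. There are
    \<open>card (L \<inter> A) * card (R \<inter> A) >= h^2\<close> of them, since disjointness
    keeps the removal of \<open>a \<in> L\<close> from lowering the count in \<open>R\<close>; and
    \<open>h^2 >= N * (N - 1) * p\<close> as \<open>N <= k\<close>.\<close>
  also have "(\<Sum>a\<in>A. \<Sum>b\<in>A - {a}. w a b) \<le> real (N * (N - 1)) * (1 - p / 2)"
  proof -
    have "(\<Sum>a\<in>A. \<Sum>b\<in>A - {a}. w a b) =
        (\<Sum>a\<in>A. \<Sum>b\<in>A - {a}. 1 - of_bool (a \<in> L) * of_bool (b \<in> R) / 2)"
      by (intro sum.cong) (auto simp: w_def)
    also have "\<dots> = (\<Sum>a\<in>A. real (N - 1) - of_bool (a \<in> L) * real (card (R \<inter> A)) / 2)"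
    proof (intro sum.cong refl)
      fix a assume a: "a \<in> A"
      have "(\<Sum>b\<in>A - {a}. 1 - of_bool (a \<in> L) * of_bool (b \<in> R) / 2) =
          real (N - 1) - of_bool (a \<in> L) * (\<Sum>b\<in>A - {a}. of_bool (b \<in> R)) / 2"
        using a by (simp add: sum_subtractf N_def sum_distrib_left sum_divide_distrib)
      also have "of_bool (a \<in> L) * (\<Sum>b\<in>A - {a}. of_bool (b \<in> R)) =
          of_bool (a \<in> L) * real (card (R \<inter> A))"
      proof (cases "a \<in> L")
        case True
        then have "a \<notin> R" using Suc.prems(3) by auto
        then have "R \<inter> A = {b \<in> A - {a}. b \<in> R}" by auto
        then show ?thesis using Suc.prems(1) by (simp add: sum.If_cases of_bool_def Int_def)
      qed simp
      finally show "(\<Sum>b\<in>A - {a}. 1 - of_bool (a \<in> L) * of_bool (b \<in> R) / 2) =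
          real (N - 1) - of_bool (a \<in> L) * real (card (R \<inter> A)) / 2" by simp
    qed
    also have "\<dots> = real (N * (N - 1)) - real (card (L \<inter> A)) * real (card (R \<inter> A)) / 2"
    proof -
      have "L \<inter> A = {a \<in> A. a \<in> L}" by auto
      then have "real (card (L \<inter> A)) = (\<Sum>a\<in>A. of_bool (a \<in> L))"
        using Suc.prems(1) by (simp add: sum.If_cases of_bool_def Int_def)
      then show ?thesis by (simp add: sum_subtractf N_def sum_distrib_right sum_divide_distrib)
    qed
    also have "\<dots> \<le> real (N * (N - 1)) * (1 - p / 2)"
    proof -
      have "real h * real h \<le> real (card (L \<inter> A)) * real (card (R \<inter> A))"
        using Suc.prems(4,5) by (intro mult_mono) auto
      moreover have "real (N * (N - 1)) * p \<le> real h * real h"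
      proof -
        have "N * (N - 1) \<le> k * k" using N2 by (intro mult_mono) auto
        then have "real (N * (N - 1)) \<le> real k * real k"
          by (metis of_nat_le_iff of_nat_mult)
        then have "real (N * (N - 1)) * p \<le> real k * real k * p"
          using p by (intro mult_right_mono) auto
        also have "\<dots> = real h * real h"
          unfolding p_def using N2 by (simp add: power2_eq_square)
        finally show ?thesis .
      qed
      ultimately show ?thesis by (simp add: algebra_simps)
    qed
    finally show ?thesis .
  qed
  also have "real (N * (N - 1)) * (1 - p / 2) * (fact (N - 2) * (1 - p / 2) ^ t) =
      fact N * (1 - p / 2) ^ Suc t"
  proof -
    have "N = Suc (Suc (N - 2))" "N - 1 = Suc (N - 2)" using N2 by auto
    then have "(fact N :: real) = real N * real (N - 1) * fact (N - 2)"
      by (metis fact_Suc mult.assoc of_nat_mult)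
    then show ?thesis by simp
  qed
  finally show ?case
    unfolding split p_def N_def using nonneg p_def N_def by (simp add: mult_right_mono)
qed

text \<open>Markov's inequality for \<open>(1/2) ^ cross_pairs\<close>: an ordering with at most
  \<open>s\<close> crossings contributes at least \<open>exp (- s * ln 2)\<close> to the sum bounded
  before, and \<open>1 - p / 2 <= exp (- p / 2)\<close> turns the power into an exponential.\<close>

lemma few_cross_pairs_permutations:
  assumes "finite A" and "card A \<le> k" and "L \<inter> R = {}"
    and "h + 2 * t \<le> card (L \<inter> A)" and "h + 2 * t \<le> card (R \<inter> A)" and "k > 0"
  shows "real (card {xs \<in> permutations_of_set A. real (cross_pairs L R t xs) \<le> s})
           \<le> fact (card A) * exp (s * ln 2 - (real h / real k)\<^sup>2 / 2 * real t)"
proof -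
  let ?F = "{xs \<in> permutations_of_set A. real (cross_pairs L R t xs) \<le> s}"
  define p where "p = (real h / real k)\<^sup>2"
  have "card (L \<inter> A) \<le> card A" using assms(1) by (intro card_mono) auto
  then have "real h / real k \<le> 1" "real h / real k \<ge> 0" using assms by (auto simp: divide_simps)
  then have p: "p \<le> 1" "p \<ge> 0" unfolding p_def by (auto intro: power_le_one)
  have "real (card ?F) * (1/2) powr s = (\<Sum>xs\<in>?F. (1/2) powr s)" by simp
  also have "\<dots> \<le> (\<Sum>xs\<in>?F. (1 / 2) ^ cross_pairs L R t xs)"
  proof (intro sum_mono)
    fix xs assume "xs \<in> ?F"
    then have "(1/2) powr s \<le> (1/2 :: real) powr (real (cross_pairs L R t xs))"
      by (intro powr_mono') auto
    then show "(1/2) powr s \<le> (1/2 :: real) ^ cross_pairs L R t xs" by (simp add: powr_realpow)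
  qed
  also have "\<dots> \<le> (\<Sum>xs\<in>permutations_of_set A. (1 / 2) ^ cross_pairs L R t xs)"
    using assms(1) by (intro sum_mono2) auto
  also have "\<dots> \<le> fact (card A) * (1 - p / 2) ^ t"
    unfolding p_def using assms by (intro sum_half_power_cross_pairs)
  also have "(1 - p / 2) ^ t \<le> exp (- (p / 2)) ^ t"
    using p exp_ge_add_one_self[of "- (p / 2)"] by (intro power_mono) auto
  also have "exp (- (p / 2)) ^ t = exp (- (p / 2 * real t))"
    by (simp only: exp_of_nat2_mult[symmetric] mult_minus_left)
  finally have "real (card ?F) * (1/2) powr s \<le> fact (card A) * exp (- (p / 2 * real t))"
    by (simp only: mult_left_mono fact_ge_zero)
  moreover have "(1/2 :: real) powr s = inverse (exp (s * ln 2))"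
    by (simp add: powr_def ln_div exp_minus)
  ultimately have "real (card ?F) \<le> fact (card A) * exp (- (p / 2 * real t)) * exp (s * ln 2)"
    by (simp add: field_simps)
  also have "\<dots> = fact (card A) * exp (s * ln 2 - p / 2 * real t)"
    by (simp only: mult.assoc exp_add[symmetric]) (simp only: minus_add_distrib diff_conv_add_uminus add.commute)
  finally show ?thesis unfolding p_def .
qed

lemma cross_pairs_eq_sum:
  assumes "2 * t \<le> length xs"
  shows "cross_pairs L R t xs = (\<Sum>i<t. of_bool (xs ! (2 * i) \<in> L \<and> xs ! (2 * i + 1) \<in> R))"
  using assms
proof (induction t arbitrary: xs)
  case 0
  then show ?case by simp
next
  case (Suc t)
  have "cross_pairs L R t (drop 2 xs) =
      (\<Sum>i<t. of_bool (xs ! (2 * Suc i) \<in> L \<and> xs ! (2 * Suc i + 1) \<in> R))"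
    using Suc.prems by (subst Suc.IH) simp_all
  then show ?case
    unfolding cross_pairs.simps sum.lessThan_Suc_shift by simp
qed

lemma cross_pairs_eq_card:
  assumes "2 * t \<le> length xs"
  shows "cross_pairs L R t xs = card {i. i < t \<and> xs ! (2 * i) \<in> L \<and> xs ! (2 * i + 1) \<in> R}"
proof -
  have "{i. i < t \<and> xs ! (2 * i) \<in> L \<and> xs ! (2 * i + 1) \<in> R} =
      {..<t} \<inter> {i. xs ! (2 * i) \<in> L \<and> xs ! (2 * i + 1) \<in> R}" by auto
  then show ?thesis unfolding cross_pairs_eq_sum[OF assms] by (simp add: sum.If_cases of_bool_def)
qed

text \<open>The realizations are split by the number \<open>j\<close> of nodes and the sets
  \<open>S\<close>, \<open>T\<close> of indices of the nodes in \<open>L\<close> and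
  \<open>R\<close>. On each class the pairing is uniform, so the counting bound for orderings
  applies with the same factor; the classes are disjoint, so this factor survives the
  summation.\<close>

lemma many_cross_pairs:
  assumes "prob_space M" and "poisson_process M d X" and "random_pairing M X"
    and "L \<in> sets borel" and "R \<in> sets borel" and "L \<inter> R = {}" and "k > 0"
  shows "\<exists>W\<in>sets M. measure M W \<le> exp (s * ln 2 - (real h / real k)\<^sup>2 / 2 * real t) \<and>
    (\<forall>\<omega>\<in>space M - W. nodes (X \<omega>) \<le> k \<longrightarrow>
       h + 2 * t \<le> node_count (X \<omega>) L \<longrightarrow> h + 2 * t \<le> node_count (X \<omega>) R \<longrightarrow>
       s < real (card {i. i < t \<and> pos (X \<omega>) (src (X \<omega>) i) \<in> L \<and> pos (X \<omega>) (dst (X \<omega>) i) \<in> R}))"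
proof -
  interpret prob_space M by fact
  define q where "q = exp (s * ln 2 - (real h / real k)\<^sup>2 / 2 * real t)"
  \<comment> \<open>Only classes that meet the hypotheses on the counts are kept;
    \<open>j <= k\<close> leaves finitely many.\<close>
  define I where "I = {(j, S, T). j \<le> k \<and> S \<subseteq> {..<j} \<and> T \<subseteq> {..<j} \<and> S \<inter> T = {} \<and>
                         h + 2 * t \<le> card S \<and> h + 2 * t \<le> card T}"
  have "finite I"
    by (rule finite_subset[of _ "{..k} \<times> Pow {..<k} \<times> Pow {..<k}"]) (auto simp: I_def)
  \<comment> \<open>\<open>random_pairing\<close> gives the conditional law on events that restrict
    each position to a Borel set; these sets prescribe for every node whether it lies in
    \<open>L\<close> and in \<open>R\<close>.\<close>
  define B where "B S T u = (if u \<in> S then L else - L) \<inter> (if u \<in> T then R else - R)"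
    for S T :: "nat set" and u
  have B[measurable]: "B S T u \<in> sets borel" for S T u
    unfolding B_def using assms(4,5) by auto
  define Q where "Q = (\<lambda>(j, S, T). {\<omega> \<in> space M. nodes (X \<omega>) = j \<and> (\<forall>u<j. pos (X \<omega>) u \<in> B S T u)})"
  define V where "V = (\<lambda>(j, S, T) xs. {\<omega> \<in> space M. nodes (X \<omega>) = j \<and> (\<forall>u<j. pos (X \<omega>) u \<in> B S T u) \<and>
                               pairing (X \<omega>) = xs})"
  define bad where "bad = (\<lambda>(j, S, T). {xs \<in> permutations_of_set {..<j :: nat}. real (cross_pairs S T t xs) \<le> s})"
  have [measurable]: "(\<lambda>\<omega>. nodes (X \<omega>)) \<in> measurable M (count_space UNIV)"
      "\<And>u. (\<lambda>\<omega>. pos (X \<omega>) u) \<in> borel_measurable M"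
      "(\<lambda>\<omega>. pairing (X \<omega>)) \<in> measurable M (count_space UNIV)"
    using assms(2,3) unfolding poisson_process_def random_pairing_def by auto
  have Q_sets: "Q x \<in> sets M" for x unfolding Q_def by (cases x) (simp, measurable)
  have V_sets: "V x xs \<in> sets M" for x xs unfolding V_def by (cases x) (simp, measurable)
  have fin_bad: "finite (bad x)" for x unfolding bad_def by (cases x) simp
  have in_Q: "S = {u. u < j \<and> pos (X \<omega>) u \<in> L} \<and> T = {u. u < j \<and> pos (X \<omega>) u \<in> R} \<and> nodes (X \<omega>) = j"
    if "\<omega> \<in> Q (j, S, T)" and "(j, S, T) \<in> I" for \<omega> j S T
    using that unfolding Q_def B_def I_def by (auto split: if_splits)
  have disj: "disjoint_family_on Q I"
    unfolding disjoint_family_on_def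
  proof (intro ballI impI, rule ccontr)
    fix x y assume xy: "x \<in> I" "y \<in> I" "x \<noteq> y" "Q x \<inter> Q y \<noteq> {}"
    then obtain \<omega> where "\<omega> \<in> Q x" "\<omega> \<in> Q y" by blast
    with xy in_Q show False by (cases x; cases y) blast
  qed
  define W where "W = (\<Union>x\<in>I. \<Union>xs\<in>bad x. V x xs)"
  have V_prob: "measure M (V x xs) = measure M (Q x) / fact (fst x)" if "x \<in> I" "xs \<in> bad x" for x xs
  proof -
    obtain j S T where x: "x = (j, S, T)" by (cases x)
    have "xs \<in> permutations_of_set {..<j}" using that(2) unfolding bad_def x by simp
    then show ?thesis using assms(3) B unfolding random_pairing_def x V_def Q_def by simp
  qed
  have bad_card: "real (card (bad x)) \<le> fact (fst x) * q" if "x \<in> I" for x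
  proof -
    obtain j S T where x: "x = (j, S, T)" by (cases x)
    have "S \<inter> {..<j} = S" "T \<inter> {..<j} = T" using that unfolding x I_def by auto
    then show ?thesis
      using few_cross_pairs_permutations[of "{..<j}" k S T h t s] that \<open>k > 0\<close>
      unfolding x I_def bad_def q_def by simp
  qed
  have "measure M W \<le> (\<Sum>x\<in>I. measure M (\<Union>xs\<in>bad x. V x xs))"
    unfolding W_def
    by (intro finite_measure_subadditive_finite \<open>finite I\<close> image_subsetI sets.finite_UN fin_bad V_sets)
  also have "\<dots> \<le> (\<Sum>x\<in>I. measure M (Q x) * q)"
  proof (rule sum_mono)
    fix x assume "x \<in> I"
    have "measure M (\<Union>xs\<in>bad x. V x xs) \<le> (\<Sum>xs\<in>bad x. measure M (V x xs))"
      by (intro finite_measure_subadditive_finite image_subsetI fin_bad V_sets)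
    also have "\<dots> = measure M (Q x) * (real (card (bad x)) / fact (fst x))"
      using V_prob[OF \<open>x \<in> I\<close>] by simp
    also have "\<dots> \<le> measure M (Q x) * q"
      using bad_card[OF \<open>x \<in> I\<close>] by (intro mult_left_mono) (auto simp: divide_le_eq mult.commute)
    finally show "measure M (\<Union>xs\<in>bad x. V x xs) \<le> measure M (Q x) * q" .
  qed
  also have "\<dots> = measure M (\<Union>x\<in>I. Q x) * q"
    using \<open>finite I\<close> disj Q_sets by (subst finite_measure_finite_Union) (auto simp: sum_distrib_right)
  also have "\<dots> \<le> 1 * q" by (intro mult_right_mono) (auto simp: q_def)
  finally have "measure M W \<le> q" by simp
  moreover have "W \<in> sets M"
    unfolding W_def by (intro sets.finite_UN \<open>finite I\<close> fin_bad V_sets)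
  moreover have "s < real (card {i. i < t \<and> pos (X \<omega>) (src (X \<omega>) i) \<in> L \<and> pos (X \<omega>) (dst (X \<omega>) i) \<in> R})"
    if \<omega>: "\<omega> \<in> space M" "\<omega> \<notin> W" and "nodes (X \<omega>) \<le> k"
      and L: "h + 2 * t \<le> node_count (X \<omega>) L" and R: "h + 2 * t \<le> node_count (X \<omega>) R" for \<omega>
  proof -
    define j where "j = nodes (X \<omega>)"
    define S where "S = {u. u < j \<and> pos (X \<omega>) u \<in> L}"
    define T where "T = {u. u < j \<and> pos (X \<omega>) u \<in> R}"
    have perm: "pairing (X \<omega>) \<in> permutations_of_set {..<j}"
      using assms(3) \<omega>(1) unfolding random_pairing_def j_def by blast
    then have len: "length (pairing (X \<omega>)) = j" and set: "set (pairing (X \<omega>)) = {..<j}"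
      using length_finite_permutations_of_set[OF perm] by (auto dest: permutations_of_setD)
    have x: "(j, S, T) \<in> I"
      using that assms(6) unfolding I_def S_def T_def j_def node_count_def by auto
    have "\<omega> \<in> V (j, S, T) (pairing (X \<omega>))"
      using \<omega>(1) unfolding V_def B_def S_def T_def j_def by auto
    with \<omega>(2) x have "pairing (X \<omega>) \<notin> bad (j, S, T)" unfolding W_def by auto
    with perm have "s < real (cross_pairs S T t (pairing (X \<omega>)))" unfolding bad_def by simp
    \<comment> \<open>The first \<open>t\<close> pairs must not run past the end of the
      ordering.\<close>
    have "2 * t \<le> j"
    proof -
      have "2 * t \<le> card S" using L unfolding node_count_def S_def j_def by simp
      also have "card S \<le> card {..<j}" by (intro card_mono) (auto simp: S_def)
      finally show ?thesis by simp
    qed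
    then have "cross_pairs S T t (pairing (X \<omega>)) =
        card {i. i < t \<and> pairing (X \<omega>) ! (2 * i) \<in> S \<and> pairing (X \<omega>) ! (2 * i + 1) \<in> T}"
      by (intro cross_pairs_eq_card) (simp add: len)
    also have "\<dots> \<le> card {i. i < t \<and> pos (X \<omega>) (src (X \<omega>) i) \<in> L \<and> pos (X \<omega>) (dst (X \<omega>) i) \<in> R}"
      by (intro card_mono) (auto simp: S_def T_def src_def dst_def)
    finally have "real (cross_pairs S T t (pairing (X \<omega>))) \<le>
        real (card {i. i < t \<and> pos (X \<omega>) (src (X \<omega>) i) \<in> L \<and> pos (X \<omega>) (dst (X \<omega>) i) \<in> R})"
      by (simp only: of_nat_le_iff)
    with \<open>s < _\<close> show ?thesis by linarith
  qed
  ultimately show ?thesis unfolding q_def by blast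
qed

section \<open>Waiting times and packet delays\<close>

lemma length_line: "length (line a b) = Suc (nat \<bar>b - a\<bar>)"
  unfolding line_def by auto

lemma length_hv_path:
  "length (hv_path c d) = Suc (nat \<bar>fst d - fst c\<bar> + nat \<bar>snd d - snd c\<bar>)"
  unfolding hv_path_def by (simp add: length_line)

lemma set_line: "set (line a b) = {min a b..max a b}"
  unfolding line_def by auto

lemma set_hv_path_cells:
  assumes "c \<in> cells K" and "d \<in> cells K"
  shows "set (hv_path c d) \<subseteq> cells K"
proof -
  have "set (tl xs) \<subseteq> set xs" for xs :: "int list" by (cases xs) auto
  then have "set (tl (line (snd c) (snd d))) \<subseteq> {min (snd c) (snd d)..max (snd c) (snd d)}"
    using set_line by metis
  then show ?thesis
    using assms unfolding hv_path_def cells_def by (fastforce simp: set_line)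
qed

lemma cell_of_point_in_cells:
  assumes "x \<in> unit_square" and "K > 0"
  shows "cell_of_point K x \<in> cells K"
proof -
  have "\<lfloor>real K * y\<rfloor> \<in> {0..<int K}" if "y \<in> {0..<1}" for y
  proof -
    have "real K * y < real K" using that assms(2) by simp
    then show ?thesis using that assms(2) by (simp add: floor_less_iff)
  qed
  then show ?thesis using assms(1) unfolding cell_of_point_def cells_def unit_square_def by auto
qed

section \<open>Waiting for transmission opportunities\<close>

lemma next_opportunity_bounds:
  assumes "\<exists>k'. k < k' \<and> k' \<le> k + w \<and> may_transmit T c k'"
  shows "k < next_opportunity T c k" and "next_opportunity T c k \<le> k + w"
proof -
  obtain k' where k': "k < k' \<and> may_transmit T c k'" "k' \<le> k + w" using assms by blast
  show "k < next_opportunity T c k"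
    unfolding next_opportunity_def using LeastI[of "\<lambda>k'. k < k' \<and> may_transmit T c k'", OF k'(1)] by blast
  show "next_opportunity T c k \<le> k + w"
    unfolding next_opportunity_def
    using Least_le[of "\<lambda>k'. k < k' \<and> may_transmit T c k'", OF k'(1)] k'(2) by linarith
qed

text \<open>Forwarding always happens in a strictly later slot and within \<open>w\<close> slots, so
  the \<open>l\<close> hops after the first cost between \<open>l\<close> and \<open>w * l\<close>
  slots.\<close>

lemma hop_slot_bounds:
  assumes "\<And>c k. c \<in> cells (grid T) \<Longrightarrow> \<exists>k'. k < k' \<and> k' \<le> k + w \<and> may_transmit T c k'"
    and "\<And>l'. l' \<le> l \<Longrightarrow> data_path T i ! l' \<in> cells (grid T)"
  shows "hop_slot T i j 0 + l \<le> hop_slot T i j l" and "hop_slot T i j l \<le> hop_slot T i j 0 + w * l"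
proof -
  have "hop_slot T i j 0 + l \<le> hop_slot T i j l \<and> hop_slot T i j l \<le> hop_slot T i j 0 + w * l"
    using assms(2)
  proof (induction l)
    case (Suc l)
    have "\<exists>k'. hop_slot T i j l < k' \<and> k' \<le> hop_slot T i j l + w \<and> may_transmit T (data_path T i ! Suc l) k'"
      using assms(1) Suc.prems by blast
    from next_opportunity_bounds[OF this] Suc show ?case by fastforce
  qed simp
  then show "hop_slot T i j 0 + l \<le> hop_slot T i j l" "hop_slot T i j l \<le> hop_slot T i j 0 + w * l"
    by auto
qed

text \<open>Here \<open>r\<close> is the side of a primary cell measured in secondary cells. A
  region starts one primary cell before \<open>b\<close>, and its length exceeds three primary cells
  by at most \<open>2 / r < 1\<close> of one. So the coordinate \<open>x\<close> can be covered only
  for the four values of \<open>b\<close> from \<open>u - 3\<close> to \<open>u\<close>, and the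
  residue of \<open>u + 1\<close> modulo 5 is free.\<close>

lemma unpreserved_residue:
  fixes x :: int
  assumes "r > 3"
  obtains \<rho> where "\<rho> \<in> {0..<5}"
    and "\<And>b. b mod 5 = \<rho> \<Longrightarrow>
           \<not> (\<lfloor>real_of_int (b - 1) * r\<rfloor> \<le> x \<and> x < \<lfloor>real_of_int (b - 1) * r\<rfloor> + (\<lfloor>3 * r\<rfloor> + 2))"
proof -
  define u where "u = \<lceil>(real_of_int x + 1) / r\<rceil>"
  have range: "b \<in> {u - 3..u}"
    if "\<lfloor>real_of_int (b - 1) * r\<rfloor> \<le> x" and lt: "x < \<lfloor>real_of_int (b - 1) * r\<rfloor> + (\<lfloor>3 * r\<rfloor> + 2)" for b
  proof -
    have "real_of_int (b - 1) * r < real_of_int x + 1" using that(1) by (simp add: floor_le_iff)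
    then have "real_of_int (b - 1) < (real_of_int x + 1) / r" using assms by (simp add: field_simps)
    also have "\<dots> \<le> real_of_int u" unfolding u_def by simp
    finally have "b \<le> u" by simp
    have "x \<le> \<lfloor>real_of_int (b - 1) * r\<rfloor> + \<lfloor>3 * r\<rfloor> + 1" using lt by simp
    then have "real_of_int x \<le> real_of_int \<lfloor>real_of_int (b - 1) * r\<rfloor> + real_of_int \<lfloor>3 * r\<rfloor> + 1"
      by linarith
    also have "\<dots> \<le> real_of_int (b - 1) * r + 3 * r + 1"
      using of_int_floor_le[of "real_of_int (b - 1) * r"] of_int_floor_le[of "3 * r"] by linarith
    finally have "(real_of_int x + 1) / r \<le> (real_of_int (b - 1) * r + 3 * r + 2) / r"
      using assms by (intro divide_right_mono) auto
    also have "\<dots> = real_of_int (b + 2) + 2 / r" using assms by (simp add: field_simps)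
    also have "\<dots> \<le> real_of_int (b + 3)" using assms by simp
    finally have "u \<le> b + 3" unfolding u_def by (simp only: ceiling_le_iff)
    with \<open>b \<le> u\<close> show ?thesis by simp
  qed
  have "b mod 5 \<noteq> (u + 1) mod 5" if "b \<in> {u - 3..u}" for b
  proof
    assume "b mod 5 = (u + 1) mod 5"
    then have "5 dvd u + 1 - b" by (metis mod_eq_dvd_iff)
    with that show False by (simp add: dvd_def) presburger
  qed
  then show ?thesis using range by (intro that[of "(u + 1) mod 5"]) (simp, metis)
qed

text \<open>A primary slot whose active position has the free residue as its first coordinate leaves
  \<open>c\<close> uncovered. Such a slot recurs every 25 primary slots, and each primary slot is
  filled by 25 secondary slots, in one of which \<open>c\<close> is active; hence the period
  625.\<close>

lemma secondary_opportunity: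
  assumes "round_robin_pattern (pattern_prim C)" and "round_robin_pattern (pattern_sec C)"
    and "grid_prim C n > 0" and "3 * grid_prim C n < grid_sec C n" and c: "c \<in> cells (grid_sec C n)"
  shows "\<exists>k'. k < k' \<and> k' \<le> k + 625 \<and> may_transmit (secondary_tier C n Xp Xs E) c k'"
proof -
  define r where "r = real (grid_sec C n) / real (grid_prim C n)"
  have "real (3 * grid_prim C n) < real (grid_sec C n)" using assms(4) by (simp only: of_nat_less_iff)
  then have "r > 3" unfolding r_def using assms(3) by (simp add: field_simps)
  have sqrt: "sqrt (cell_area (grid_prim C n) / cell_area (grid_sec C n)) = r"
    unfolding cell_area_def r_def by (simp add: real_sqrt_divide)
  obtain \<rho> where \<rho>: "\<rho> \<in> {0..<5}" "\<And>b. b mod 5 = \<rho> \<Longrightarrow>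
      \<not> (\<lfloor>real_of_int (b - 1) * r\<rfloor> \<le> fst c \<and> fst c < \<lfloor>real_of_int (b - 1) * r\<rfloor> + (\<lfloor>3 * r\<rfloor> + 2))"
    using unpreserved_residue[OF \<open>r > 3\<close>, of "fst c"] by metis
  \<comment> \<open>The second coordinate 0 is an arbitrary choice, since the first coordinate alone
    keeps the regions away from \<open>c\<close>.\<close>
  have "(\<rho>, 0) \<in> pattern_prim C ` {..<25}"
    using assms(1) \<rho>(1) unfolding round_robin_pattern_def bij_betw_def by auto
  then obtain q0 where q0: "q0 < 25" "pattern_prim C q0 = (\<rho>, 0)" by auto
  have "(fst c mod 5, snd c mod 5) \<in> pattern_sec C ` {..<25}"
    using assms(2) unfolding round_robin_pattern_def bij_betw_def by auto
  then obtain k0 where k0: "k0 < 25" "pattern_sec C k0 = (fst c mod 5, snd c mod 5)" by auto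
  have unpreserved: "c \<notin> preserved C n (primary_tier C n Xp E) q" if "q mod 25 = q0" for q
  proof
    assume "c \<in> preserved C n (primary_tier C n Xp E) q"
    then obtain b where b: "active (pattern_prim C) b q"
        "c \<in> preservation_region (grid_prim C n) (grid_sec C n) b"
      unfolding preserved_def primary_tier_def by auto
    from b(1) have "fst b mod 5 = \<rho>" unfolding active_def that q0(2) by simp
    from \<rho>(2)[OF this] b(2) show False
      unfolding preservation_region_def Let_def sqrt
      by (cases c) (auto simp: r_def)
  qed
  have ok: "may_transmit (secondary_tier C n Xp Xs E) c (25 * Q + k0)" if "Q mod 25 = q0" for Q
  proof -
    have "(25 * Q + k0) mod 25 = k0" "(25 * Q + k0) div 25 = Q" using k0(1) by auto
    then show ?thesis
      using c unpreserved[OF that] k0(2) unfolding secondary_tier_def active_def by simp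
  qed
  define e where "e = 25 * q0 + k0"
  have "e < 625" unfolding e_def using q0(1) k0(1) by linarith
  have ok': "may_transmit (secondary_tier C n Xp Xs E) c (625 * y + e)" for y
    using ok[of "25 * y + q0"] q0(1) unfolding e_def by (simp add: algebra_simps)
  obtain y z where k: "k = 625 * y + z" "z < 625" by (metis mod_less_divisor mult_div_mod_eq zero_less_numeral)
  \<comment> \<open>The opportunities found are the slots congruent to \<open>e\<close> modulo 625.
    If \<open>k\<close> is itself one of them, the strict inequality forces the full wait of 625
    slots until the next.\<close>
  show ?thesis
  proof (cases "z < e")
    case True
    then show ?thesis using ok'[of y] k \<open>e < 625\<close> by (intro exI[of _ "625 * y + e"]) auto
  next
    case False
    then show ?thesis using ok'[of "y + 1"] k \<open>e < 625\<close> by (intro exI[of _ "625 * (y + 1) + e"]) auto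
  qed
qed

section \<open>Long-run averages of packet delays\<close>

lemma pair_delay_ge:
  assumes "\<And>j. a \<le> packet_delay_of T E i j"
  shows "ennreal a \<le> pair_delay T E i"
proof -
  have "ennreal a = limsup (\<lambda>k::nat. ennreal a)" by (simp add: Limsup_const)
  also have "\<dots> \<le> pair_delay T E i"
    unfolding pair_delay_def
  proof (rule Limsup_mono)
    \<comment> \<open>Passing to positive \<open>k\<close> keeps the average away from the quotient
      0 / 0.\<close>
    show "\<forall>\<^sub>F k in sequentially. ennreal a \<le> (\<Sum>j<k. ennreal (packet_delay_of T E i j)) / of_nat k"
      using eventually_gt_at_top[of 0]
    proof eventually_elim
      case (elim k)
      have "ennreal a = of_nat k * ennreal a / of_nat k"
        using elim by (simp add: ennreal_mult_divide_eq mult.commute)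
      also have "\<dots> = (\<Sum>j<k. ennreal a) / of_nat k" by simp
      also have "\<dots> \<le> (\<Sum>j<k. ennreal (packet_delay_of T E i j)) / of_nat k"
        using assms by (intro divide_right_mono_ennreal sum_mono ennreal_leI)
      finally show ?case .
    qed
  qed
  finally show ?thesis .
qed

lemma pair_delay_le:
  assumes "\<And>j. packet_delay_of T E i j \<le> a"
  shows "pair_delay T E i \<le> ennreal a"
proof -
  have "pair_delay T E i \<le> limsup (\<lambda>k::nat. ennreal a)"
    unfolding pair_delay_def
  proof (rule Limsup_mono)
    show "\<forall>\<^sub>F k in sequentially. (\<Sum>j<k. ennreal (packet_delay_of T E i j)) / of_nat k \<le> ennreal a"
      using eventually_gt_at_top[of 0]
    proof eventually_elim
      case (elim k)
      have "(\<Sum>j<k. ennreal (packet_delay_of T E i j)) / of_nat k \<le> (\<Sum>j<k. ennreal a) / of_nat k"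
        using assms by (intro divide_right_mono_ennreal sum_mono ennreal_leI)
      also have "\<dots> = of_nat k * ennreal a / of_nat k" by simp
      also have "\<dots> = ennreal a"
        using elim by (simp add: ennreal_mult_divide_eq mult.commute)
      finally show ?case .
    qed
  qed
  also have "\<dots> = ennreal a" by (simp add: Limsup_const)
  finally show ?thesis .
qed

section \<open>Delay of a single packet\<close>

lemma pairing_in_nodes:
  fixes X :: "('r) network_scheme"
  assumes "pairing X \<in> permutations_of_set {..<nodes X}" and "i < n_pairs X"
  shows "src X i < nodes X" and "dst X i < nodes X"
proof -
  have len: "length (pairing X) = nodes X"
    using assms(1) length_finite_permutations_of_set by fastforce
  have set: "set (pairing X) = {..<nodes X}" using assms(1) by (rule permutations_of_setD)
  have "2 * i + 1 < nodes X" using assms(2) unfolding n_pairs_def by linarith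
  then show "src X i < nodes X" "dst X i < nodes X"
    using set len nth_mem[of "2 * i" "pairing X"] nth_mem[of "2 * i + 1" "pairing X"]
    unfolding src_def dst_def by auto
qed

text \<open>These properties hold at every sample point of a random network; isolating them lets the
  delay bounds be proved for one fixed realization.\<close>

definition well_placed :: "network \<Rightarrow> bool" where
  "well_placed X \<longleftrightarrow> pairing X \<in> permutations_of_set {..<nodes X} \<and>
                   (\<forall>u<nodes X. pos X u \<in> unit_square)"

lemma secondary_tier_simps [simp]:
  "nodes (secondary_tier C n Xp Xs E) = nodes Xs"
  "pos (secondary_tier C n Xp Xs E) = pos Xs"
  "pairing (secondary_tier C n Xp Xs E) = pairing Xs"
  "grid (secondary_tier C n Xp Xs E) = grid_sec C n"
  "slot_len (secondary_tier C n Xp Xs E) = slot_prim C / 25"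
  "n_pairs (secondary_tier C n Xp Xs E) = n_pairs Xs"
  "src (secondary_tier C n Xp Xs E) = src Xs"
  "dst (secondary_tier C n Xp Xs E) = dst Xs"
  unfolding secondary_tier_def n_pairs_def src_def dst_def by (simp_all add: fun_eq_iff)

lemma data_path_secondary:
  assumes "well_placed Xs" and "grid_sec C n > 0" and "i < n_pairs Xs"
    and T_def: "T = secondary_tier C n Xp Xs E"
  shows "set (data_path T i) \<subseteq> cells (grid T)" and "hops T i \<le> 2 * grid_sec C n"
    and "hops T i \<le> length (data_path T i)"
proof -
  have "node_cell T (src T i) \<in> cells (grid T)" "node_cell T (dst T i) \<in> cells (grid T)"
    using assms pairing_in_nodes[of Xs i]
    unfolding node_cell_def well_placed_def by (auto intro!: cell_of_point_in_cells)
  note ends = this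
  show "set (data_path T i) \<subseteq> cells (grid T)"
    unfolding data_path_def by (rule set_hv_path_cells[OF ends])
  have "length (data_path T i) \<le> Suc (2 * (grid_sec C n - 1))"
    using ends assms(2) unfolding data_path_def length_hv_path cells_def T_def by auto
  then show "hops T i \<le> 2 * grid_sec C n"
    unfolding hops_def using assms(2) by auto
  show "hops T i \<le> length (data_path T i)"
    unfolding hops_def data_path_def length_hv_path by simp
qed

text \<open>A departure lies somewhere in its slot and an arrival somewhere in its own, so the slot
  numbers determine the delay up to one slot either way. With \<open>hops - 1\<close> forwardings
  this leaves \<open>hops - 2\<close> slots below; above, the extra slot is absorbed by
  \<open>w >= 1\<close>.\<close>

lemma packet_delay_bounds:
  assumes valid: "valid_execution C n Xp Xs E" and "well_placed Xs" and "grid_sec C n > 0"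
    and "i < n_pairs Xs" and "slot_prim C > 0"
    and opp: "\<And>c k. c \<in> cells (grid_sec C n) \<Longrightarrow>
           \<exists>k'. k < k' \<and> k' \<le> k + w \<and> may_transmit (secondary_tier C n Xp Xs E) c k'"
    and "w > 0"
  defines "T \<equiv> secondary_tier C n Xp Xs E"
  shows "slot_prim C / 25 * (real (hops T i) - 2) \<le> packet_delay_of T E i j"
    and "packet_delay_of T E i j \<le> slot_prim C / 25 * (real w * real (hops T i))"
    and "0 \<le> packet_delay_of T E i j"
proof -
  define t where "t = slot_prim C / 25"
  have "t > 0" unfolding t_def using assms(5) by simp
  note path = data_path_secondary[OF assms(2-4) T_def[THEN meta_eq_to_obj_eq]]
  define l where "l = hops T i - 1"
  have hops: "hops T i = Suc l" unfolding l_def hops_def by simp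
  have slots: "hop_slot T i j 0 + l \<le> hop_slot T i j l" "hop_slot T i j l \<le> hop_slot T i j 0 + w * l"
  proof -
    have "data_path T i ! l' \<in> cells (grid T)" if "l' \<le> l" for l'
      using that path(1,3) hops nth_mem[of l' "data_path T i"] by auto
    note * = hop_slot_bounds[of T w l i j, OF _ this]
    show "hop_slot T i j 0 + l \<le> hop_slot T i j l"
      by (rule *(1)) (use opp in \<open>simp_all add: T_def\<close>)
    show "hop_slot T i j l \<le> hop_slot T i j 0 + w * l"
      by (rule *(2)) (use opp in \<open>simp_all add: T_def\<close>)
  qed
  \<comment> \<open>The packet slot of the path is a subinterval of the slot, so its two ends may be
    replaced by those of the whole slot.\<close>
  have times: "t * real (hop_slot T i j l') \<le> depart E i j l' \<and>
      arrive E i j l' \<le> t * (real (hop_slot T i j l') + 1) \<and> depart E i j l' < arrive E i j l'"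
    if "l' < hops T i" for l'
  proof -
    let ?k = "hop_slot T i j l'"
    let ?ps = "order T (data_path T i ! l') ?k"
    have "(\<exists>a<length ?ps. ?ps ! a = i \<and>
                 slot_len T * (real ?k + real a / real (length ?ps)) \<le> depart E i j l' \<and>
                 arrive E i j l' \<le> slot_len T * (real ?k + real (a + 1) / real (length ?ps))) \<and>
              depart E i j l' < arrive E i j l'"
      using valid that assms(4) unfolding valid_execution_def Let_def T_def by simp
    then obtain a where a: "a < length ?ps"
        "t * (real ?k + real a / real (length ?ps)) \<le> depart E i j l'"
        "arrive E i j l' \<le> t * (real ?k + real (a + 1) / real (length ?ps))"
        "depart E i j l' < arrive E i j l'"
      unfolding t_def T_def by auto
    have "t * real ?k \<le> t * (real ?k + real a / real (length ?ps))"
      using \<open>t > 0\<close> by (intro mult_left_mono) auto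
    moreover have "t * (real ?k + real (a + 1) / real (length ?ps)) \<le> t * (real ?k + 1)"
    proof (intro mult_left_mono add_left_mono)
      have "real (a + 1) \<le> real (length ?ps)" using a(1) by linarith
      then show "real (a + 1) / real (length ?ps) \<le> 1" using a(1) by (simp add: divide_le_eq)
    qed (use \<open>t > 0\<close> in auto)
    ultimately show ?thesis using a by linarith
  qed
  note t0 = times[of 0] and tl = times[of l]
  have D: "packet_delay_of T E i j = arrive E i j l - depart E i j 0"
    unfolding packet_delay_of_def l_def ..
  have "real (hop_slot T i j 0 + l) \<le> real (hop_slot T i j l)" using slots(1) by (simp only: of_nat_le_iff)
  then have "t * (real (hop_slot T i j 0) + real l) \<le> t * real (hop_slot T i j l)"
    using \<open>t > 0\<close> by (intro mult_left_mono) auto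
  then have "t * (real (hops T i) - 2) \<le> arrive E i j l - depart E i j 0"
    using t0 tl hops by (simp add: algebra_simps)
  then show "slot_prim C / 25 * (real (hops T i) - 2) \<le> packet_delay_of T E i j"
    unfolding D t_def .
  \<comment> \<open>For a single hop the lower bound above is negative, and nonnegativity comes from
    \<open>depart < arrive\<close> instead.\<close>
  show "0 \<le> packet_delay_of T E i j"
  proof (cases "l = 0")
    case True
    then show ?thesis using tl hops unfolding D by simp
  next
    case False
    then have "1 \<le> real l" by linarith
    then have "t * 1 \<le> t * real l" using \<open>t > 0\<close> by (intro mult_left_mono) auto
    with \<open>t * (real (hops T i) - 2) \<le> arrive E i j l - depart E i j 0\<close> show ?thesis
      unfolding D hops by (simp add: algebra_simps)
  qed
  have "real (hop_slot T i j l) \<le> real (hop_slot T i j 0 + w * l)" using slots(2) by (simp only: of_nat_le_iff)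
  also have "\<dots> + 1 \<le> real (hop_slot T i j 0) + real w * real (hops T i)"
    unfolding hops using \<open>w > 0\<close> by (simp add: algebra_simps)
  finally have "t * (real (hop_slot T i j l) + 1) \<le> t * (real (hop_slot T i j 0) + real w * real (hops T i))"
    using \<open>t > 0\<close> by (intro mult_left_mono) auto
  then have "arrive E i j l - depart E i j 0 \<le> t * (real w * real (hops T i))"
    using t0 tl hops by (simp add: algebra_simps)
  then show "packet_delay_of T E i j \<le> slot_prim C / 25 * (real w * real (hops T i))"
    unfolding D t_def .
qed

section \<open>Averages over the pairs\<close>

lemma two_divide_of_nat_ennreal:
  assumes "N > 0"
  shows "2 / of_nat N = ennreal (2 / real N)"
  using assms by (subst divide_ennreal[symmetric]) (simp_all add: ennreal_of_nat_eq_real_of_nat)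

lemma sum_const_ennreal:
  assumes "a \<ge> 0"
  shows "(\<Sum>i\<in>A. ennreal a) = ennreal (real (card A) * a)"
  using assms by (simp add: ennreal_mult ennreal_of_nat_eq_real_of_nat)

lemma secondary_delay_le:
  assumes "prob_space R" and "\<And>i. i < n_pairs Xs \<Longrightarrow>
      AE \<rho> in R. pair_delay (secondary_tier C n Xp Xs (E \<rho>)) (E \<rho>) i \<le> ennreal a"
    and "a \<ge> 0"
  shows "secondary_delay C n Xp Xs R E \<le> ennreal a"
proof (cases "nodes Xs = 0")
  \<comment> \<open>In \<open>ennreal\<close> the factor \<open>2 / 0\<close> is infinite, but it
    multiplies an empty sum, and the product is 0.\<close>
  case True
  then show ?thesis unfolding secondary_delay_def n_pairs_def by simp
next
  case False
  let ?S = "\<Sum>i<n_pairs Xs. \<integral>\<^sup>+\<rho>. pair_delay (secondary_tier C n Xp Xs (E \<rho>)) (E \<rho>) i \<partial>R"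
  have "(\<integral>\<^sup>+\<rho>. pair_delay (secondary_tier C n Xp Xs (E \<rho>)) (E \<rho>) i \<partial>R) \<le> ennreal a"
    if "i < n_pairs Xs" for i
    using nn_integral_mono_AE[OF assms(2)[OF that]]
    by (simp add: prob_space.emeasure_space_1[OF assms(1)])
  then have "?S \<le> (\<Sum>i<n_pairs Xs. ennreal a)" by (intro sum_mono) simp
  then have sum: "?S \<le> ennreal (real (n_pairs Xs) * a)"
    unfolding sum_const_ennreal[OF assms(3)] card_lessThan .
  have "secondary_delay C n Xp Xs R E = ennreal (2 / real (nodes Xs)) * ?S"
    unfolding secondary_delay_def using False by (subst two_divide_of_nat_ennreal) simp_all
  also have "\<dots> \<le> ennreal (2 / real (nodes Xs)) * ennreal (real (n_pairs Xs) * a)"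
    by (rule mult_left_mono[OF sum]) simp
  also have "\<dots> = ennreal (2 / real (nodes Xs) * (real (n_pairs Xs) * a))"
    using assms(3) by (intro ennreal_mult[symmetric]) auto
  also have "\<dots> = ennreal (2 * real (n_pairs Xs) / real (nodes Xs) * a)"
    by (simp only: times_divide_eq_left mult.assoc)
  also have "\<dots> \<le> ennreal (1 * a)"
  proof (intro ennreal_leI mult_right_mono)
    have "2 * n_pairs Xs \<le> nodes Xs" unfolding n_pairs_def by simp
    then have "2 * real (n_pairs Xs) \<le> real (nodes Xs)" by linarith
    then show "2 * real (n_pairs Xs) / real (nodes Xs) \<le> 1" using False by (simp add: divide_le_eq)
  qed (use assms(3) in auto)
  finally show ?thesis by simp
qed

lemma secondary_delay_ge:
  assumes "prob_space R" and "G \<subseteq> {..<n_pairs Xs}" and "\<And>i. i \<in> G \<Longrightarrow>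
      AE \<rho> in R. ennreal a \<le> pair_delay (secondary_tier C n Xp Xs (E \<rho>)) (E \<rho>) i"
    and "a \<ge> 0" and "nodes Xs > 0"
  shows "ennreal (2 / real (nodes Xs) * (real (card G) * a)) \<le> secondary_delay C n Xp Xs R E"
proof -
  let ?I = "\<lambda>i. \<integral>\<^sup>+\<rho>. pair_delay (secondary_tier C n Xp Xs (E \<rho>)) (E \<rho>) i \<partial>R"
  have "ennreal a \<le> ?I i" if "i \<in> G" for i
    using nn_integral_mono_AE[OF assms(3)[OF that]]
    by (simp add: prob_space.emeasure_space_1[OF assms(1)])
  then have "(\<Sum>i\<in>G. ennreal a) \<le> (\<Sum>i\<in>G. ?I i)" by (intro sum_mono) simp
  also have "\<dots> \<le> (\<Sum>i<n_pairs Xs. ?I i)" using assms(2) by (intro sum_mono2) simp_all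
  finally have sum: "ennreal (real (card G) * a) \<le> (\<Sum>i<n_pairs Xs. ?I i)"
    unfolding sum_const_ennreal[OF assms(4)] .
  have "ennreal (2 / real (nodes Xs) * (real (card G) * a)) =
      ennreal (2 / real (nodes Xs)) * ennreal (real (card G) * a)"
    using assms(4) by (intro ennreal_mult) auto
  also have "\<dots> \<le> ennreal (2 / real (nodes Xs)) * (\<Sum>i<n_pairs Xs. ?I i)"
    by (rule mult_left_mono[OF sum]) simp
  also have "\<dots> = secondary_delay C n Xp Xs R E"
    unfolding secondary_delay_def two_divide_of_nat_ennreal[OF assms(5)] ..
  finally show ?thesis .
qed

section \<open>Pairs that cross the square\<close>

definition left_strip :: "point set" where
  "left_strip = {0..<1/4} \<times> {0..<1}"

definition right_strip :: "point set" where
  "right_strip = {3/4..<1} \<times> {0..<1}"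

text \<open>The strips are 1/2 apart, so the horizontal leg alone accounts for at least
  \<open>K / 2 - 1\<close> hops on a grid of size \<open>K\<close>; from \<open>K = 12\<close> on,
  \<open>K / 2 - 3 >= K / 4\<close>.\<close>

lemma hops_across_strips:
  assumes "pos T (src T i) \<in> left_strip" and "pos T (dst T i) \<in> right_strip" and "grid T \<ge> 12"
  shows "real (grid T) / 4 \<le> real (hops T i) - 2"
proof -
  let ?K = "real (grid T)"
  let ?x = "fst (pos T (src T i))" and ?y = "fst (pos T (dst T i))"
  have "?x \<le> 1/4" "3/4 \<le> ?y"
    using assms(1,2) unfolding left_strip_def right_strip_def by (auto simp: mem_Times_iff)
  then have "?K * ?x \<le> ?K * (1/4)" "?K * (3/4) \<le> ?K * ?y" by (intro mult_left_mono; simp)+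
  then have "?K / 2 - 1 \<le> real_of_int (\<lfloor>?K * ?y\<rfloor> - \<lfloor>?K * ?x\<rfloor>)" by linarith
  also have "\<dots> \<le> real (hops T i)"
  proof -
    have "\<lfloor>?K * ?y\<rfloor> - \<lfloor>?K * ?x\<rfloor> \<le> int (hops T i)"
      unfolding hops_def data_path_def length_hv_path node_cell_def cell_of_point_def by simp
    then show ?thesis by linarith
  qed
  finally show ?thesis using assms(3) by linarith
qed

text \<open>The constants come from the slot length \<open>slot_prim C / 25\<close>. Above, at most
  \<open>2 * K\<close> hops of 625 slots each give \<open>50 * slot_prim C * K\<close>; below, a
  crossing pair needs at least \<open>K / 4\<close> slots, that is,
  \<open>slot_prim C / 100 * K\<close>.\<close>

lemma secondary_delay_bounds:
  assumes "prob_space R" and "AE \<rho> in R. valid_execution C n Xp Xs (E \<rho>)" and "well_placed Xs"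
    and "round_robin_pattern (pattern_prim C)" and "round_robin_pattern (pattern_sec C)"
    and "grid_prim C n > 0" and "3 * grid_prim C n < grid_sec C n" and "slot_prim C > 0"
  shows "secondary_delay C n Xp Xs R E \<le> ennreal (50 * slot_prim C * real (grid_sec C n))"
    and "grid_sec C n \<ge> 12 \<Longrightarrow> nodes Xs > 0 \<Longrightarrow>
      ennreal (2 / real (nodes Xs) *
        (real (card {i. i < n_pairs Xs \<and> pos Xs (src Xs i) \<in> left_strip \<and> pos Xs (dst Xs i) \<in> right_strip}) *
         (slot_prim C / 100 * real (grid_sec C n)))) \<le> secondary_delay C n Xp Xs R E"
proof -
  have K: "grid_sec C n > 0" using assms(7) by linarith
  note opp = secondary_opportunity[OF assms(4-7)]
  note delay = packet_delay_bounds[OF _ assms(3) K _ assms(8) opp, of Xp, simplified]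
  show "secondary_delay C n Xp Xs R E \<le> ennreal (50 * slot_prim C * real (grid_sec C n))"
  proof (rule secondary_delay_le[OF assms(1)])
    fix i assume i: "i < n_pairs Xs"
    show "AE \<rho> in R. pair_delay (secondary_tier C n Xp Xs (E \<rho>)) (E \<rho>) i
            \<le> ennreal (50 * slot_prim C * real (grid_sec C n))"
      using assms(2)
    proof eventually_elim
      case (elim \<rho>)
      show ?case
      proof (rule pair_delay_le)
        fix j
        have "real (hops (secondary_tier C n Xp Xs (E \<rho>)) i) \<le> 2 * real (grid_sec C n)"
          using data_path_secondary(2)[OF assms(3) K i refl, of Xp "E \<rho>"] by linarith
        then have "slot_prim C * real (hops (secondary_tier C n Xp Xs (E \<rho>)) i) * 25
            \<le> slot_prim C * (2 * real (grid_sec C n)) * 25"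
          using assms(8) by (intro mult_right_mono mult_left_mono) auto
        then show "packet_delay_of (secondary_tier C n Xp Xs (E \<rho>)) (E \<rho>) i j
            \<le> 50 * slot_prim C * real (grid_sec C n)"
          using delay(2)[OF elim i, of j] by (simp add: mult_ac)
      qed
    qed
  qed (use assms(8) in simp)
  assume "grid_sec C n \<ge> 12" and "nodes Xs > 0"
  let ?G = "{i. i < n_pairs Xs \<and> pos Xs (src Xs i) \<in> left_strip \<and> pos Xs (dst Xs i) \<in> right_strip}"
  show "ennreal (2 / real (nodes Xs) * (real (card ?G) * (slot_prim C / 100 * real (grid_sec C n))))
          \<le> secondary_delay C n Xp Xs R E"
  proof (rule secondary_delay_ge[OF assms(1)])
    fix i assume i: "i \<in> ?G"
    show "AE \<rho> in R. ennreal (slot_prim C / 100 * real (grid_sec C n))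
            \<le> pair_delay (secondary_tier C n Xp Xs (E \<rho>)) (E \<rho>) i"
      using assms(2)
    proof eventually_elim
      case (elim \<rho>)
      show ?case
      proof (rule pair_delay_ge)
        fix j
        let ?T = "secondary_tier C n Xp Xs (E \<rho>)"
        have "real (grid_sec C n) / 4 \<le> real (hops ?T i) - 2"
          using hops_across_strips[of ?T i] i \<open>grid_sec C n \<ge> 12\<close> by simp
        then have "slot_prim C / 25 * (real (grid_sec C n) / 4) \<le> slot_prim C / 25 * (real (hops ?T i) - 2)"
          using assms(8) by (intro mult_left_mono) auto
        then show "slot_prim C / 100 * real (grid_sec C n) \<le> packet_delay_of ?T (E \<rho>) i j"
          using delay(1)[OF elim, of i j] i by simp
      qed
    qed
  qed (use assms(8) \<open>nodes Xs > 0\<close> in auto)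
qed

section \<open>Asymptotics\<close>

text \<open>A good event need only exist for each large \<open>n\<close> separately; the choice
  operator joins these events into the family that \<open>whp\<close> asks for.\<close>

lemma whpI:
  assumes "\<forall>\<^sub>F n in at_top. \<exists>A\<in>sets (M n). (\<forall>\<omega>\<in>A. P n \<omega>) \<and> 1 - e n \<le> measure (M n) A"
    and "\<forall>\<^sub>F n in at_top. prob_space (M n)" and "(e \<longlongrightarrow> 0) at_top"
  shows "whp M P"
proof -
  define Q where "Q n A \<longleftrightarrow> A \<in> sets (M n) \<and> (\<forall>\<omega>\<in>A. P n \<omega>) \<and> 1 - e n \<le> measure (M n) A" for n A
  define A where "A n = (SOME A. Q n A)" for n
  have "\<forall>\<^sub>F n in at_top. \<exists>A. Q n A"
    using assms(1) by eventually_elim (auto simp: Q_def)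
  then have "\<forall>\<^sub>F n in at_top. Q n (A n)"
    unfolding A_def by eventually_elim (rule someI_ex)
  then have A: "\<forall>\<^sub>F n in at_top. A n \<in> sets (M n) \<and> (\<forall>\<omega>\<in>A n. P n \<omega>) \<and> 1 - e n \<le> measure (M n) (A n)"
    unfolding Q_def .
  have lim: "((\<lambda>n. 1 - e n) \<longlongrightarrow> 1) at_top" using tendsto_diff[OF tendsto_const assms(3), of 1] by simp
  have "((\<lambda>n. measure (M n) (A n)) \<longlongrightarrow> 1) at_top"
    using lim tendsto_const
  proof (rule tendsto_sandwich[rotated 2])
    show "\<forall>\<^sub>F n in at_top. 1 - e n \<le> measure (M n) (A n)" using A by eventually_elim blast
    show "\<forall>\<^sub>F n in at_top. measure (M n) (A n) \<le> 1"
      using assms(2) by eventually_elim (rule prob_space.prob_le_1)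
  qed
  moreover have "\<forall>\<^sub>F n in at_top. A n \<in> sets (M n) \<and> (\<forall>\<omega>\<in>A n. P n \<omega>)"
    using A by eventually_elim blast
  ultimately show ?thesis unfolding whp_def by blast
qed

text \<open>\<open>U\<close> collects the failures of the Poisson counts in the square and in both
  strips, and of the pairing given those counts. Off \<open>U\<close> there are at most
  \<open>2 * d\<close> nodes and at least \<open>d / 8\<close> in each strip, half the mean
  \<open>d / 4\<close>, so that \<open>many_cross_pairs\<close> applies.\<close>

lemma many_pairs_across_strips:
  assumes "random_network M d X" and "d \<ge> 64"
  shows "\<exists>U\<in>sets M.
    measure M U \<le> exp ((1 - 2 * ln 2) * d) + 2 * exp ((ln 2 - 1) / 8 * d) + exp (- d / 1048576) \<and>
    (\<forall>\<omega>\<in>space M - U. 0 < nodes (X \<omega>) \<and> real (nodes (X \<omega>)) \<le> 2 * d \<and>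
       d / 1048576 \<le> real (card {i. i < n_pairs (X \<omega>) \<and> pos (X \<omega>) (src (X \<omega>) i) \<in> left_strip \<and>
                                    pos (X \<omega>) (dst (X \<omega>) i) \<in> right_strip}))"
proof -
  have M: "prob_space M" and PP: "poisson_process M d X" and RP: "random_pairing M X"
    using assms(1) unfolding random_network_def by auto
  interpret prob_space M by fact
  have strips: "left_strip \<in> sets borel" "right_strip \<in> sets borel" "unit_square \<in> sets borel"
      "left_strip \<subseteq> unit_square" "right_strip \<subseteq> unit_square" "left_strip \<inter> right_strip = {}"
    unfolding left_strip_def right_strip_def unit_square_def
    by (auto intro: borel_rectangle)
  have areas: "measure lborel left_strip = 1/4" "measure lborel right_strip = 1/4"
      "measure lborel unit_square = 1"
    unfolding left_strip_def right_strip_def unit_square_def by (simp_all add: measure_lborel_rectangle)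
  have "d \<ge> 0" using assms(2) by simp
  \<comment> \<open>The choices satisfy \<open>h + 2 * t <= d / 8\<close>, and
    \<open>d >= 64\<close> lets rounding cost at most a factor 2. As \<open>h / k >= 1/64\<close>,
    each of the \<open>t\<close> pairs contributes at least 1/8192 to the negative part of the
    exponent; \<open>s\<close> uses up at most half of that, leaving
    \<open>t / 16384 >= d / 1048576\<close>.\<close>
  define t where "t = nat \<lfloor>d / 32\<rfloor>"
  define h where "h = nat \<lfloor>d / 16\<rfloor>"
  define k where "k = nat \<lfloor>2 * d\<rfloor>"
  define s where "s = real t / 16384"
  have t: "d / 64 \<le> real t" "real t \<le> d / 32" unfolding t_def using assms(2) by linarith+
  have h: "d / 32 \<le> real h" "real h \<le> d / 16" unfolding h_def using assms(2) by linarith+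
  have k: "real k \<le> 2 * d" "k > 0" unfolding k_def using assms(2) by linarith+
  obtain W where W: "W \<in> sets M" "measure M W \<le> exp (s * ln 2 - (real h / real k)\<^sup>2 / 2 * real t)"
    "\<forall>\<omega>\<in>space M - W. nodes (X \<omega>) \<le> k \<longrightarrow> h + 2 * t \<le> node_count (X \<omega>) left_strip \<longrightarrow>
       h + 2 * t \<le> node_count (X \<omega>) right_strip \<longrightarrow>
       s < real (card {i. i < t \<and> pos (X \<omega>) (src (X \<omega>) i) \<in> left_strip \<and> pos (X \<omega>) (dst (X \<omega>) i) \<in> right_strip})"
    using many_cross_pairs[OF M PP RP strips(1,2,6) k(2), of s h t] by blast
  have "measure M W \<le> exp (- d / 1048576)"
  proof -
    have "d / 32 / (2 * d) \<le> real h / real k" using h k assms(2) by (intro frac_le) auto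
    then have "1/64 \<le> real h / real k" using assms(2) by simp
    then have "(1/64)\<^sup>2 \<le> (real h / real k)\<^sup>2" by (intro power_mono) auto
    then have "1/8192 \<le> (real h / real k)\<^sup>2 / 2" by (simp only: power_one_over) simp
    then have "1/8192 * real t \<le> (real h / real k)\<^sup>2 / 2 * real t"
      by (rule mult_right_mono) simp
    moreover have "s * ln 2 \<le> s * 1" using ln_2_less_1 unfolding s_def by (intro mult_left_mono) auto
    ultimately have "s * ln 2 - (real h / real k)\<^sup>2 / 2 * real t \<le> - d / 1048576"
      using t(1) unfolding s_def by linarith
    with W(2) show ?thesis by (meson exp_le_cancel_iff order_trans)
  qed
  define U1 where "U1 = {\<omega> \<in> space M. \<not> real (node_count (X \<omega>) unit_square) \<le> 2 * (d * measure lborel unit_square)}"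
  define U2 where "U2 = {\<omega> \<in> space M. \<not> real (node_count (X \<omega>) left_strip) \<ge> d * measure lborel left_strip / 2}"
  define U3 where "U3 = {\<omega> \<in> space M. \<not> real (node_count (X \<omega>) right_strip) \<ge> d * measure lborel right_strip / 2}"
  have sets: "U1 \<in> sets M" "U2 \<in> sets M" "U3 \<in> sets M"
    unfolding U1_def U2_def U3_def using strips by (auto intro: node_count_sets[OF M PP])
  have "measure M U1 \<le> exp ((1 - 2 * ln 2) * d)"
    using node_count_upper_tail[OF M PP strips(3) subset_refl \<open>d \<ge> 0\<close>] unfolding U1_def areas by simp
  moreover have "measure M U2 \<le> exp ((ln 2 - 1) / 8 * d)"
    using node_count_lower_tail[OF M PP strips(1,4) \<open>d \<ge> 0\<close>] unfolding U2_def areas by simp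
  moreover have "measure M U3 \<le> exp ((ln 2 - 1) / 8 * d)"
    using node_count_lower_tail[OF M PP strips(2,5) \<open>d \<ge> 0\<close>] unfolding U3_def areas by simp
  moreover have "measure M (U1 \<union> U2 \<union> U3 \<union> W) \<le> measure M U1 + measure M U2 + measure M U3 + measure M W"
    using sets W(1) by (intro order_trans[OF measure_Un_le] add_right_mono) auto
  ultimately have "measure M (U1 \<union> U2 \<union> U3 \<union> W)
      \<le> exp ((1 - 2 * ln 2) * d) + 2 * exp ((ln 2 - 1) / 8 * d) + exp (- d / 1048576)"
    using \<open>measure M W \<le> exp (- d / 1048576)\<close> by linarith
  moreover have "U1 \<union> U2 \<union> U3 \<union> W \<in> sets M" using sets W(1) by auto
  moreover have "0 < nodes (X \<omega>) \<and> real (nodes (X \<omega>)) \<le> 2 * d \<and>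
      d / 1048576 \<le> real (card {i. i < n_pairs (X \<omega>) \<and> pos (X \<omega>) (src (X \<omega>) i) \<in> left_strip \<and>
                                   pos (X \<omega>) (dst (X \<omega>) i) \<in> right_strip})"
    if \<omega>: "\<omega> \<in> space M" and notin: "\<omega> \<notin> U1 \<union> U2 \<union> U3 \<union> W" for \<omega>
  proof -
    have "\<forall>u<nodes (X \<omega>). pos (X \<omega>) u \<in> unit_square"
      using PP \<omega> unfolding poisson_process_def by blast
    then have "{u. u < nodes (X \<omega>) \<and> pos (X \<omega>) u \<in> unit_square} = {..<nodes (X \<omega>)}" by auto
    then have "node_count (X \<omega>) unit_square = nodes (X \<omega>)" unfolding node_count_def by simp
    then have N: "real (nodes (X \<omega>)) \<le> 2 * d"
      using notin \<omega> unfolding U1_def areas by auto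
    then have "nodes (X \<omega>) \<le> k" unfolding k_def by linarith
    have L: "d / 8 \<le> real (node_count (X \<omega>) left_strip)" and R: "d / 8 \<le> real (node_count (X \<omega>) right_strip)"
      using notin \<omega> unfolding U2_def U3_def areas by auto
    have "real (h + 2 * t) \<le> d / 8" using h t by simp
    with L R have LR: "h + 2 * t \<le> node_count (X \<omega>) left_strip" "h + 2 * t \<le> node_count (X \<omega>) right_strip"
      by linarith+
    have "node_count (X \<omega>) left_strip \<le> card {..<nodes (X \<omega>)}"
      unfolding node_count_def by (intro card_mono) auto
    with LR(1) have "2 * t \<le> nodes (X \<omega>)" by simp
    moreover have "t > 0" using t(1) assms(2) by linarith
    ultimately have "nodes (X \<omega>) > 0" "t \<le> n_pairs (X \<omega>)" unfolding n_pairs_def by linarith+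
    have "s < real (card {i. i < t \<and> pos (X \<omega>) (src (X \<omega>) i) \<in> left_strip \<and> pos (X \<omega>) (dst (X \<omega>) i) \<in> right_strip})"
      using W(3) \<omega> \<open>nodes (X \<omega>) \<le> k\<close> LR notin by blast
    also have "card {i. i < t \<and> pos (X \<omega>) (src (X \<omega>) i) \<in> left_strip \<and> pos (X \<omega>) (dst (X \<omega>) i) \<in> right_strip}
        \<le> card {i. i < n_pairs (X \<omega>) \<and> pos (X \<omega>) (src (X \<omega>) i) \<in> left_strip \<and> pos (X \<omega>) (dst (X \<omega>) i) \<in> right_strip}"
      using \<open>t \<le> n_pairs (X \<omega>)\<close> by (intro card_mono) auto
    finally show ?thesis using N \<open>nodes (X \<omega>) > 0\<close> t(1) unfolding s_def by simp
  qed
  ultimately show ?thesis by blast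
qed

text \<open>Up to a constant, the ratio of the two grid sizes before rounding is
  \<open>n powr ((\<beta> - 1) / 2)\<close>, which tends to infinity because
  \<open>\<beta> > 1\<close>.\<close>

lemma grids_eventually:
  assumes "density_exp C > 1" and "k_prim C \<ge> 1" and "k_sec C = k_prim C"
  shows "\<forall>\<^sub>F n in at_top. 0 < grid_prim C n \<and> 3 * grid_prim C n < grid_sec C n \<and> 12 \<le> grid_sec C n"
proof -
  define \<beta> c where "\<beta> = density_exp C" and "c = k_prim C"
  have pos: "\<beta> > 1" "c > 0" using assms unfolding \<beta>_def c_def by auto
  define fp where "fp n = 1 / sqrt (nominal_area c n)" for n
  define fs where "fs n = 1 / sqrt (nominal_area c (n powr \<beta>))" for n
  have "filterlim fp at_top at_top"
    unfolding fp_def nominal_area_def using pos by real_asymp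
  then have 1: "\<forall>\<^sub>F n in at_top. 12 \<le> fp n" unfolding filterlim_at_top by blast
  have "filterlim (\<lambda>n. fs n / fp n) at_top at_top"
    unfolding fp_def fs_def nominal_area_def using pos by real_asymp
  then have 2: "\<forall>\<^sub>F n in at_top. 4 \<le> fs n / fp n" unfolding filterlim_at_top by blast
  from 1 2 show ?thesis
  proof eventually_elim
    case (elim n)
    have gp: "grid_prim C n = nat \<lfloor>fp n\<rfloor>" and gs: "grid_sec C n = nat \<lfloor>fs n\<rfloor>"
      unfolding grid_prim_def grid_sec_def grid_size_def fp_def fs_def c_def m_of_def \<beta>_def assms(3) by simp_all
    \<comment> \<open>The margin between the factors 4 and 3 is \<open>fp n >= 12\<close>; it
      absorbs the rounding and keeps the inequality strict.\<close>
    have "4 * fp n \<le> fs n" using elim by (simp add: field_simps)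
    then show ?case unfolding gp gs using elim(1) by linarith
  qed
qed

text \<open>A number \<open>y >= 1\<close> has floor at least \<open>y / 2\<close>, so passing
  between the grid size and \<open>1 / sqrt a\<close> costs only a constant factor.\<close>

lemma grid_size_bounds:
  assumes "1 / sqrt a \<ge> 1"
  shows "real (grid_size a) \<le> 1 / sqrt a" and "1 / sqrt a \<le> 2 * real (grid_size a)"
proof -
  obtain y where y: "y = 1 / sqrt a" by simp
  with assms have "y \<ge> 1" by simp
  then have "real (nat \<lfloor>y\<rfloor>) = real_of_int \<lfloor>y\<rfloor>" "1 \<le> real_of_int \<lfloor>y\<rfloor>" by auto
  then have "real (nat \<lfloor>y\<rfloor>) \<le> y" "y \<le> 2 * real (nat \<lfloor>y\<rfloor>)" by linarith+
  then show "real (grid_size a) \<le> 1 / sqrt a" "1 / sqrt a \<le> 2 * real (grid_size a)"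
    unfolding grid_size_def y .
qed

theorem theorem4:
  fixes C :: parameters
    and M :: "real \<Rightarrow> 'a measure" and Xp Xs :: "real \<Rightarrow> 'a \<Rightarrow> network"
    and R :: "real \<Rightarrow> 'b measure" and E :: "real \<Rightarrow> 'a \<Rightarrow> 'b \<Rightarrow> execution"
  assumes "path_loss C > 2" and "noise_power C > 0" and "density_exp C > 1"
    and "k_prim C \<ge> 1" and "k_sec C = k_prim C"
    and "power_prim C > 0" and "power_sec C > 0" and "slot_prim C > 0"
    and "round_robin_pattern (pattern_prim C)" and "round_robin_pattern (pattern_sec C)"
    and primary: "\<And>n. n > 0 \<Longrightarrow> random_network (M n) n (Xp n)"
    and secondary: "\<And>n. n > 0 \<Longrightarrow> random_network (M n) (m_of C n) (Xs n)"
    and "\<And>n. prob_space (R n)"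
    and protocols: "\<forall>\<^sub>F n in at_top. AE \<omega> in M n.
           all_occupied (grid_prim C n) (Xp n \<omega>) \<and> all_occupied (grid_sec C n) (Xs n \<omega>) \<longrightarrow>
           (AE \<rho> in R n. valid_execution C n (Xp n \<omega>) (Xs n \<omega>) (E n \<omega> \<rho>))"
  shows "theta_whp M (\<lambda>n \<omega>. secondary_delay C n (Xp n \<omega>) (Xs n \<omega>) (R n) (E n \<omega>))
           (\<lambda>n. 1 / sqrt (nominal_area (k_sec C) (m_of C n)))"
proof -
  let ?m = "m_of C"
  let ?D = "\<lambda>n \<omega>. secondary_delay C n (Xp n \<omega>) (Xs n \<omega>) (R n) (E n \<omega>)"
  let ?f = "\<lambda>n. 1 / sqrt (nominal_area (k_sec C) (m_of C n))"
  \<comment> \<open>The failure probability has three sources: an empty primary cell, an empty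
    secondary cell, and the exceptional set of \<open>many_pairs_across_strips\<close> at the
    secondary density.\<close>
  define e where "e n = 1 / ln n + 1 / ln (?m n) +
    (exp ((1 - 2 * ln 2) * ?m n) + 2 * exp ((ln 2 - 1) / 8 * ?m n) + exp (- ?m n / 1048576))" for n
  \<comment> \<open>For secondary density \<open>m\<close>, \<open>c1\<close> arises from the factor
    \<open>2 / (2 * m)\<close>, at least \<open>m / 1048576\<close> crossing pairs, and the delay
    \<open>slot_prim C / 100 * K\<close>, where the grid size \<open>K\<close> is at least half its
    value before rounding.\<close>
  define c1 where "c1 = slot_prim C / (200 * 1048576)"
  define c2 where "c2 = 50 * slot_prim C"
  have m_top: "filterlim ?m at_top at_top"
    unfolding m_of_def using assms(3) by real_asymp
  have "whp M (\<lambda>n \<omega>. ennreal (c1 * ?f n) \<le> ?D n \<omega> \<and> ?D n \<omega> \<le> ennreal (c2 * ?f n))"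
  proof (rule whpI)
    \<comment> \<open>The two rates that involve \<open>ln 2\<close> are negative because ln 2 lies
      between 1/2 and 1.\<close>
    have "((\<lambda>m::real. exp ((1 - 2 * ln 2) * m)) \<longlongrightarrow> 0) at_top"
    proof -
      have "1 - 2 * ln 2 < (0::real)" using ln2_ge_two_thirds by simp
      then show ?thesis by real_asymp
    qed
    moreover have "((\<lambda>m::real. exp ((ln 2 - 1) / 8 * m)) \<longlongrightarrow> 0) at_top"
    proof -
      have "(ln 2 - 1) / 8 < (0::real)" using ln_2_less_1 by simp
      then show ?thesis by real_asymp
    qed
    moreover have "((\<lambda>m::real. exp (- m / 1048576)) \<longlongrightarrow> 0) at_top" by real_asymp
    moreover have "((\<lambda>m::real. 1 / ln m) \<longlongrightarrow> 0) at_top" by real_asymp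
    ultimately have lims: "((\<lambda>n. 1 / ln n) \<longlongrightarrow> (0::real)) at_top"
        "((\<lambda>n. 1 / ln (?m n)) \<longlongrightarrow> 0) at_top"
        "((\<lambda>n. exp ((1 - 2 * ln 2) * ?m n)) \<longlongrightarrow> 0) at_top"
        "((\<lambda>n. exp ((ln 2 - 1) / 8 * ?m n)) \<longlongrightarrow> 0) at_top"
        "((\<lambda>n. exp (- ?m n / 1048576)) \<longlongrightarrow> 0) at_top"
      using m_top filterlim_compose by fast+
    have "(e \<longlongrightarrow> 0 + 0 + (0 + 2 * 0 + 0)) at_top"
      unfolding e_def by (intro tendsto_add tendsto_mult tendsto_const lims)
    then show "(e \<longlongrightarrow> 0) at_top" by simp
    show "\<forall>\<^sub>F n in at_top. prob_space (M n)"
      using eventually_gt_at_top[of 0] by eventually_elim (use primary in \<open>simp add: random_network_def\<close>)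
    have "\<forall>\<^sub>F n in at_top. 64 \<le> ?m n" using m_top unfolding filterlim_at_top by blast
    then show "\<forall>\<^sub>F n in at_top. \<exists>A\<in>sets (M n).
        (\<forall>\<omega>\<in>A. ennreal (c1 * ?f n) \<le> ?D n \<omega> \<and> ?D n \<omega> \<le> ennreal (c2 * ?f n)) \<and> 1 - e n \<le> measure (M n) A"
      using eventually_gt_at_top[of 1] grids_eventually[OF assms(3-5)] protocols
    proof eventually_elim
      case (elim n)
      have rnp: "random_network (M n) n (Xp n)" and rns: "random_network (M n) (?m n) (Xs n)"
        using primary secondary elim(2) by auto
      then have M: "prob_space (M n)" and PPp: "poisson_process (M n) n (Xp n)"
          and PPs: "poisson_process (M n) (?m n) (Xs n)"
        unfolding random_network_def by auto
      interpret prob_space "M n" by fact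
      define Up where "Up = {\<omega> \<in> space (M n). \<not> all_occupied (grid_prim C n) (Xp n \<omega>)}"
      define Us where "Us = {\<omega> \<in> space (M n). \<not> all_occupied (grid_sec C n) (Xs n \<omega>)}"
      have Up: "Up \<in> sets (M n)" "measure (M n) Up \<le> 1 / ln n"
        unfolding Up_def grid_prim_def using not_all_occupied_prob[OF M PPp elim(2) assms(4)] by auto
      have "?m n > 1" "k_sec C \<ge> 1" using elim(1) assms(4,5) by auto
      then have Us: "Us \<in> sets (M n)" "measure (M n) Us \<le> 1 / ln (?m n)"
        unfolding Us_def grid_sec_def using not_all_occupied_prob[OF M PPs] by auto
      obtain U where U: "U \<in> sets (M n)" "measure (M n) U
          \<le> exp ((1 - 2 * ln 2) * ?m n) + 2 * exp ((ln 2 - 1) / 8 * ?m n) + exp (- ?m n / 1048576)"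
        "\<forall>\<omega>\<in>space (M n) - U. 0 < nodes (Xs n \<omega>) \<and> real (nodes (Xs n \<omega>)) \<le> 2 * ?m n \<and>
          ?m n / 1048576 \<le> real (card {i. i < n_pairs (Xs n \<omega>) \<and>
            pos (Xs n \<omega>) (src (Xs n \<omega>) i) \<in> left_strip \<and> pos (Xs n \<omega>) (dst (Xs n \<omega>) i) \<in> right_strip})"
        using many_pairs_across_strips[OF rns elim(1)] by blast
      \<comment> \<open>The assumption on the protocols holds almost surely, so the points where it
        may fail are enclosed in a null set.\<close>
      from elim(4) obtain V where V: "V \<in> null_sets (M n)"
        "{\<omega> \<in> space (M n). \<not> (all_occupied (grid_prim C n) (Xp n \<omega>) \<and> all_occupied (grid_sec C n) (Xs n \<omega>) \<longrightarrow>
           (AE \<rho> in R n. valid_execution C n (Xp n \<omega>) (Xs n \<omega>) (E n \<omega> \<rho>)))} \<subseteq> V"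
        unfolding eventually_ae_filter by blast
      define B where "B = Up \<union> Us \<union> U \<union> V"
      have "V \<in> sets (M n)" "measure (M n) V = 0" using V(1) by (auto simp: null_sets_def measure_def)
      then have B: "B \<in> sets (M n)" unfolding B_def using Up Us U by auto
      have "measure (M n) B \<le> measure (M n) Up + measure (M n) Us + measure (M n) U + measure (M n) V"
        unfolding B_def using Up Us U \<open>V \<in> sets (M n)\<close>
        by (intro order_trans[OF measure_Un_le] add_right_mono) auto
      also have "\<dots> \<le> e n" unfolding e_def using Up Us U \<open>measure (M n) V = 0\<close> by linarith
      finally have "1 - e n \<le> measure (M n) (space (M n) - B)" using prob_compl[OF B] by simp
      moreover have "ennreal (c1 * ?f n) \<le> ?D n \<omega> \<and> ?D n \<omega> \<le> ennreal (c2 * ?f n)"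
        if "\<omega> \<in> space (M n) - B" for \<omega>
      proof -
        have \<omega>: "\<omega> \<in> space (M n)" "\<omega> \<notin> Up" "\<omega> \<notin> Us" "\<omega> \<notin> U" "\<omega> \<notin> V"
          using that unfolding B_def by auto
        then have valid: "AE \<rho> in R n. valid_execution C n (Xp n \<omega>) (Xs n \<omega>) (E n \<omega> \<rho>)"
          using V(2) unfolding Up_def Us_def by blast
        have wp: "well_placed (Xs n \<omega>)"
          using rns \<omega>(1) unfolding well_placed_def random_network_def poisson_process_def random_pairing_def
          by blast
        have grids: "grid_prim C n > 0" "3 * grid_prim C n < grid_sec C n" "12 \<le> grid_sec C n"
          using elim(3) by auto
        define K where "K = real (grid_sec C n)"
        have "K \<ge> 12" unfolding K_def using grids(3) by simp
        \<comment> \<open>The floor of this value is \<open>K >= 12\<close>, so the value itself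
          cannot be below 1.\<close>
        then have "?f n \<ge> 1" unfolding K_def grid_sec_def grid_size_def by linarith
        from grid_size_bounds[OF this] have K: "K \<le> ?f n" "?f n \<le> 2 * K" unfolding K_def grid_sec_def by auto
        note bounds = secondary_delay_bounds[OF assms(13) valid wp assms(9,10) grids(1,2) assms(8), folded K_def]
        have "?D n \<omega> \<le> ennreal (50 * slot_prim C * K)" by (rule bounds(1))
        also have "\<dots> \<le> ennreal (c2 * ?f n)"
          unfolding c2_def using K assms(8) by (intro ennreal_leI mult_left_mono) auto
        finally have upper: "?D n \<omega> \<le> ennreal (c2 * ?f n)" .
        define g where "g = real (card {i. i < n_pairs (Xs n \<omega>) \<and>
            pos (Xs n \<omega>) (src (Xs n \<omega>) i) \<in> left_strip \<and> pos (Xs n \<omega>) (dst (Xs n \<omega>) i) \<in> right_strip})"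
        have N: "0 < nodes (Xs n \<omega>)" "real (nodes (Xs n \<omega>)) \<le> 2 * ?m n" "?m n / 1048576 \<le> g"
          using U(3) \<omega>(1,4) unfolding g_def by blast+
        have "c1 * ?f n \<le> c1 * (2 * K)" using K assms(8) unfolding c1_def by (intro mult_left_mono) auto
        also have "\<dots> = 2 / (2 * ?m n) * (?m n / 1048576 * (slot_prim C / 100 * K))"
          unfolding c1_def using elim(1) by simp
        also have "\<dots> \<le> 2 / real (nodes (Xs n \<omega>)) * (g * (slot_prim C / 100 * K))"
          using N \<open>K \<ge> 12\<close> assms(8) elim(1)
          by (intro mult_mono divide_left_mono mult_nonneg_nonneg) auto
        finally have "ennreal (c1 * ?f n) \<le> ennreal (2 / real (nodes (Xs n \<omega>)) * (g * (slot_prim C / 100 * K)))"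
          by (rule ennreal_leI)
        also have "\<dots> \<le> ?D n \<omega>" unfolding g_def by (rule bounds(2)[OF grids(3) N(1)])
        finally show ?thesis using upper by blast
      qed
      ultimately show ?case using B by (intro bexI[of _ "space (M n) - B"]) auto
    qed
  qed
  moreover have "c1 > 0" "c2 > 0" unfolding c1_def c2_def using assms(8) by auto
  ultimately show ?thesis unfolding theta_whp_def by blast
qed

end
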